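(* Let $T$ be as in the context and assume that, for the integer $k\ge1$ with $(A-\mathrm{Id})^k\neq0$ and $(A-\mathrm{Id})^{k+1}=0$, the image $\{\mathbf y(A-\mathrm{Id})^k:\mathbf y\in\mathbb R^d\}$ equals $\mathbb R\mathbf e_d$. Let $\Psi^\perp\in\mathscr Q(d)$ be a trigonometric polynomial which is not a measurable coboundary for $T$. Then for every $C>1$, $$\lim_{n\to\infty}\lambda_d\big(\{\mathbf x\in\mathbb T^d:|S_n(\Psi^\perp)(\mathbf x)|<C\}\big)=0.$$
   Context: Let $d\ge2$, $\mathbb T^d=\mathbb R^d/\mathbb Z^d$ with points as row vectors $\mathbf x=(x_1,\dots,x_d)$ and Lebesgue probability measure $\lambda_d$; $\mathbf e_d$ is the last standard basis vector. $A$ is a $d\times d$ upper triangular unipotent integer matrix, $A\neq\mathrm{Id}$, $\mathbf b\in\mathbb T^d$, $T\mathbf x=\mathbf xA+\mathbf b$, assumed uniquely ergodic. $S_n(\Phi)=\sum_{i=0}^{n-1}\Phi\circ T^i$. $\mathscr Q(d)$ is the set of trigonometric polynomials $\Phi$ on $\mathbb T^d$ with $\int_0^1\Phi\,dx_d\equiv0$. $\Phi$ is a measurable coboundary for $T$ if $\Phi=u\circ T-u$ a.e. for some measurable $u$. *)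

theory Defs
  imports "HOL-Probability.Probability"
begin

text \<open>Conventions. Points of the torus are represented by their unique
representatives in the unit cube [0,1)^d, as extensional functions on the
index set {..<d} (coordinates 0,...,d-1; the last coordinate is d-1, so
e_d is the indicator of index d-1). Integer d x d matrices are functions
nat => nat => int, only entries with indices < d matter.\<close>

definition torus :: "nat \<Rightarrow> (nat \<Rightarrow> real) measure" where
  "torus d = PiM {..<d} (\<lambda>_. restrict_space lborel {0..<1})"

definition mat_mult :: "nat \<Rightarrow> (nat \<Rightarrow> nat \<Rightarrow> int) \<Rightarrow> (nat \<Rightarrow> nat \<Rightarrow> int) \<Rightarrow> (nat \<Rightarrow> nat \<Rightarrow> int)" where
  "mat_mult d M N = (\<lambda>i j. \<Sum>l<d. M i l * N l j)"

definition id_mat :: "nat \<Rightarrow> nat \<Rightarrow> int" where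
  "id_mat = (\<lambda>i j. if i = j then 1 else 0)"

fun mat_pow :: "nat \<Rightarrow> (nat \<Rightarrow> nat \<Rightarrow> int) \<Rightarrow> nat \<Rightarrow> (nat \<Rightarrow> nat \<Rightarrow> int)" where
  "mat_pow d M 0 = id_mat"
| "mat_pow d M (Suc n) = mat_mult d (mat_pow d M n) M"

definition mat_is_zero :: "nat \<Rightarrow> (nat \<Rightarrow> nat \<Rightarrow> int) \<Rightarrow> bool" where
  "mat_is_zero d M \<longleftrightarrow> (\<forall>i<d. \<forall>j<d. M i j = 0)"

definition minus_id :: "(nat \<Rightarrow> nat \<Rightarrow> int) \<Rightarrow> (nat \<Rightarrow> nat \<Rightarrow> int)" where
  "minus_id A = (\<lambda>i j. A i j - id_mat i j)"

definition upper_unipotent :: "nat \<Rightarrow> (nat \<Rightarrow> nat \<Rightarrow> int) \<Rightarrow> bool" where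
  "upper_unipotent d A \<longleftrightarrow> (\<forall>i<d. A i i = 1) \<and> (\<forall>i<d. \<forall>j<i. A i j = 0)"

definition row_mult :: "nat \<Rightarrow> (nat \<Rightarrow> real) \<Rightarrow> (nat \<Rightarrow> nat \<Rightarrow> int) \<Rightarrow> (nat \<Rightarrow> real)" where
  "row_mult d y M = (\<lambda>j\<in>{..<d}. \<Sum>i<d. y i * real_of_int (M i j))"

definition affine_map :: "nat \<Rightarrow> (nat \<Rightarrow> nat \<Rightarrow> int) \<Rightarrow> (nat \<Rightarrow> real) \<Rightarrow> (nat \<Rightarrow> real) \<Rightarrow> (nat \<Rightarrow> real)" where
  "affine_map d A b x = (\<lambda>j\<in>{..<d}. frac ((\<Sum>i<d. x i * real_of_int (A i j)) + b j))"

definition uniquely_ergodic :: "nat \<Rightarrow> ((nat \<Rightarrow> real) \<Rightarrow> (nat \<Rightarrow> real)) \<Rightarrow> bool" where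
  "uniquely_ergodic d T \<longleftrightarrow>
     (\<exists>!\<mu>. sets \<mu> = sets (torus d) \<and> prob_space \<mu> \<and>
           T \<in> measurable \<mu> \<mu> \<and> distr \<mu> \<mu> T = \<mu>)"

definition birkhoff_sum :: "((nat \<Rightarrow> real) \<Rightarrow> (nat \<Rightarrow> real)) \<Rightarrow> nat \<Rightarrow> ((nat \<Rightarrow> real) \<Rightarrow> complex) \<Rightarrow> (nat \<Rightarrow> real) \<Rightarrow> complex" where
  "birkhoff_sum T n \<Phi> x = (\<Sum>i<n. \<Phi> ((T ^^ i) x))"

definition trig_poly :: "nat \<Rightarrow> ((nat \<Rightarrow> real) \<Rightarrow> complex) \<Rightarrow> bool" where
  "trig_poly d \<Phi> \<longleftrightarrow> (\<exists>K c. finite K \<and>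
     (\<forall>x. \<Phi> x = (\<Sum>k\<in>K. c k * exp (2 * of_real pi * \<i> * of_real (\<Sum>i<d. real_of_int (k i) * x i)))))"

definition Qd :: "nat \<Rightarrow> ((nat \<Rightarrow> real) \<Rightarrow> complex) set" where
  "Qd d = {\<Phi>. trig_poly d \<Phi> \<and> (\<forall>x. (LBINT t=0..1. \<Phi> (x(d - 1 := t))) = 0)}"

definition measurable_coboundary :: "nat \<Rightarrow> ((nat \<Rightarrow> real) \<Rightarrow> (nat \<Rightarrow> real)) \<Rightarrow> ((nat \<Rightarrow> real) \<Rightarrow> complex) \<Rightarrow> bool" where
  "measurable_coboundary d T \<Phi> \<longleftrightarrow>
     (\<exists>u \<in> borel_measurable (torus d). AE x in torus d. \<Phi> x = u (T x) - u x)"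

end

theory Submission
  imports Defs
begin

text \<open>Write \<open>N = A - Id\<close>. As \<open>N^k\<close> maps some \<open>w\<close> to \<open>e_d\<close> and \<open>N^(k+1) = 0\<close>, moving \<open>x\<close> by the tiny vector
  \<open>t w / (n choose k)\<close> moves \<open>T^n x\<close> by \<open>t e_d\<close> up to an error tending to 0. For fixed \<open>l\<close> and large \<open>n\<close>
  the sum \<open>S_l (T^n x)\<close>, a trigonometric polynomial without constant term in the last coordinate, is
  therefore spread out independently of \<open>S_l x\<close>: the set where \<open>|S_l (T^n x) - S_l x| < 2C\<close> has hardly
  more measure than the set where \<open>|S_l| \<le> \<kappa>\<close>, with \<open>\<kappa>\<close> independent of \<open>l\<close>.

  If \<open>|S_n| < C\<close> had measure at least \<open>\<epsilon>\<close> for infinitely many \<open>n\<close>, then two of the preimages of this set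
  under \<open>T^0, T^s, ..., T^((J-1)s)\<close> would overlap substantially, and the identity
  \<open>S_n (T^l x) - S_n x = S_l (T^n x) - S_l x\<close> would make \<open>|S_l| \<le> \<kappa>\<close> a set of measure bounded below for some
  \<open>l\<close> in \<open>{s, 2s, ..., (J-1)s}\<close>, whatever \<open>s\<close>. Hence the measures of \<open>|S_l| \<le> \<kappa>\<close> would not tend to 0 in the Cesaro
  sense. But then, for the skew product \<open>(x, r) \<mapsto> (T x, r + \<phi> x)\<close> with \<open>\<phi>\<close> the real or the imaginary part of
  \<open>\<Psi>\<close>, the points returning to a bounded strip with positive frequency form an invariant set of positive
  measure, which is finite by the maximal ergodic theorem. The medians of its fibres are a measurable
  transfer function for \<open>\<phi>\<close>, so \<open>\<Psi>\<close> would be a coboundary.\<close>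

section \<open>Affine maps of the torus\<close>

abbreviation unit_lborel :: "real measure" where
  "unit_lborel \<equiv> restrict_space lborel {0..<1}"

lemma prob_space_unit_lborel: "prob_space unit_lborel"
  by (rule prob_spaceI) (simp add: space_restrict_space emeasure_restrict_space)

lemma prob_space_torus: "prob_space (torus d)"
  unfolding torus_def by (rule prob_space_PiM) (rule prob_space_unit_lborel)

lemma space_torus: "space (torus d) = {..<d} \<rightarrow>\<^sub>E {0..<1}"
  by (auto simp: torus_def space_PiM space_restrict_space)

lemma torus_component_measurable:
  assumes "i < d" shows "(\<lambda>x. x i) \<in> borel_measurable (torus d)"
proof -
  have "(\<lambda>x. x i) \<in> measurable (torus d) unit_lborel"
    unfolding torus_def using assms by (intro measurable_component_singleton) auto
  moreover have "(\<lambda>y. y) \<in> measurable unit_lborel borel"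
    by (intro measurable_restrict_space1) auto
  ultimately show ?thesis by (rule measurable_compose)
qed

lemma measurable_frac [measurable]: "(frac :: real \<Rightarrow> real) \<in> borel_measurable borel"
  unfolding frac_def by measurable

lemma affine_map_measurable [measurable]: "affine_map d A b \<in> measurable (torus d) (torus d)"
proof -
  have "(\<lambda>x. frac ((\<Sum>i<d. x i * real_of_int (A i j)) + b j)) \<in> measurable (torus d) unit_lborel" for j
  proof -
    have "(\<lambda>x. (\<Sum>i<d. x i * real_of_int (A i j)) + b j) \<in> borel_measurable (torus d)"
      by (intro borel_measurable_add borel_measurable_sum borel_measurable_times
          torus_component_measurable borel_measurable_const) auto
    from measurable_compose[OF this measurable_frac] show ?thesis
      by (intro measurable_restrict_space2) (auto simp: frac_lt_1)
  qed
  then have "(\<lambda>x. \<lambda>j\<in>{..<d}. frac ((\<Sum>i<d. x i * real_of_int (A i j)) + b j))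
    \<in> measurable (torus d) (PiM {..<d} (\<lambda>_. unit_lborel))"
    by (intro measurable_restrict) auto
  then show ?thesis unfolding affine_map_def[abs_def] torus_def[symmetric] .
qed

text \<open>Only \<open>c = frac s\<close> matters modulo 1, and the shift by \<open>c\<close>
  exchanges the intervals [0,1-c) and [1-c,1); on each piece translation invariance on the line
  applies.\<close>

lemma nn_integral_unit_lborel_shift:
  fixes g :: "real \<Rightarrow> ennreal"
  assumes [measurable]: "g \<in> borel_measurable unit_lborel"
  shows "(\<integral>\<^sup>+y. g (frac (y + s)) \<partial>unit_lborel) = (\<integral>\<^sup>+y. g y \<partial>unit_lborel)"
proof -
  define c where "c = frac s"
  have c: "0 \<le> c" "c < 1" by (auto simp: c_def frac_lt_1)
  define h where "h y = g y * indicator {0..<1} y" for y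
  have [measurable]: "h \<in> borel_measurable borel"
    using assms unfolding h_def by (subst (asm) borel_measurable_restrict_space_iff_ennreal) auto
  have fr: "frac (y + s) = (if y < 1 - c then y + c else y + c - 1)" if "y \<in> {0..<1}" for y
  proof -
    have "frac (y + s) = frac (y + c)"
      by (simp add: c_def frac_def floor_add floor_diff_of_int algebra_simps flip: of_int_add)
    also have "\<dots> = (if y < 1 - c then y + c else y + c - 1)"
    proof (cases "y < 1 - c")
      case True then show ?thesis using that c by (simp add: frac_eq)
    next
      case False
      have "frac (y + c) = frac (y + c - 1)" using frac_1_eq[of "y + c - 1"] by simp
      then show ?thesis using False that c frac_eq[of "y + c - 1"] by simp
    qed
    finally show ?thesis .
  qed
  have "(\<integral>\<^sup>+y. g (frac (y + s)) \<partial>unit_lborel) = (\<integral>\<^sup>+y. g (frac (y + s)) * indicator {0..<1} y \<partial>lborel)"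
    by (subst nn_integral_restrict_space) auto
  also have "\<dots> = (\<integral>\<^sup>+y. h (c + y) * indicator {c..<1} (c + y) + h (c - 1 + y) * indicator {0..<c} (c - 1 + y) \<partial>lborel)"
  proof (rule nn_integral_cong)
    fix y :: real
    consider "y < 0 \<or> 1 \<le> y" | "0 \<le> y" "y < 1 - c" | "1 - c \<le> y" "y < 1" by linarith
    then show "g (frac (y + s)) * indicator {0..<1} y =
        h (c + y) * indicator {c..<1} (c + y) + h (c - 1 + y) * indicator {0..<c} (c - 1 + y)"
    proof cases
      case 1 then show ?thesis using c by (auto simp: indicator_def)
    next
      case 2 then show ?thesis using c fr[of y] by (simp add: h_def indicator_def add.commute)
    next
      case 3
      then have "frac (y + s) = c - 1 + y" using c fr[of y] by simp
      then show ?thesis using c 3 by (simp add: h_def indicator_def)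
    qed
  qed
  also have "\<dots> = (\<integral>\<^sup>+y. h (c + y) * indicator {c..<1} (c + y) \<partial>lborel) + (\<integral>\<^sup>+y. h (c - 1 + y) * indicator {0..<c} (c - 1 + y) \<partial>lborel)"
    by (rule nn_integral_add) auto
  also have "(\<integral>\<^sup>+y. h (c + y) * indicator {c..<1} (c + y) \<partial>lborel) = (\<integral>\<^sup>+y. h y * indicator {c..<1} y \<partial>lborel)"
    using nn_integral_real_affine[of "\<lambda>y. h y * indicator {c..<1} y" 1 c] by simp
  also have "(\<integral>\<^sup>+y. h (c - 1 + y) * indicator {0..<c} (c - 1 + y) \<partial>lborel) = (\<integral>\<^sup>+y. h y * indicator {0..<c} y \<partial>lborel)"
    using nn_integral_real_affine[of "\<lambda>y. h y * indicator {0..<c} y" 1 "c - 1"] by simp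
  also have "(\<integral>\<^sup>+y. h y * indicator {c..<1} y \<partial>lborel) + (\<integral>\<^sup>+y. h y * indicator {0..<c} y \<partial>lborel)
     = (\<integral>\<^sup>+y. h y * indicator {c..<1} y + h y * indicator {0..<c} y \<partial>lborel)"
    by (rule nn_integral_add[symmetric]) auto
  also have "\<dots> = (\<integral>\<^sup>+y. g y * indicator {0..<1} y \<partial>lborel)"
    by (rule nn_integral_cong) (use c in \<open>auto simp: h_def indicator_def\<close>)
  also have "\<dots> = (\<integral>\<^sup>+y. g y \<partial>unit_lborel)"
    by (subst nn_integral_restrict_space) auto
  finally show ?thesis .
qed

text \<open>Induction on the dimension. By triangularity the first \<open>d\<close> coordinates of
  the image depend only on those of \<open>x\<close>, and the unit diagonal turns the last
  coordinate into a rotation by an amount depending on them. Integrating over the last coordinate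
  first, rotation invariance leaves the case of dimension \<open>d\<close>.\<close>

lemma nn_integral_affine_map:
  assumes "upper_unipotent d A" "g \<in> borel_measurable (torus d)"
  shows "(\<integral>\<^sup>+x. g (affine_map d A b x) \<partial>torus d) = (\<integral>\<^sup>+x. g x \<partial>torus d)"
  using assms
proof (induction d arbitrary: g)
  case 0
  show ?case by (rule nn_integral_cong) (simp add: space_torus affine_map_def)
next
  case (Suc d)
  interpret product_sigma_finite "\<lambda>_::nat. unit_lborel"
    by (simp add: product_sigma_finite_def prob_space_unit_lborel prob_space_imp_sigma_finite)
  have uni: "upper_unipotent d A" and last_row: "\<And>j. j < d \<Longrightarrow> A d j = 0" and diag: "A d d = 1"
    using Suc.prems(1) by (auto simp: upper_unipotent_def)
  have ins: "torus (Suc d) = PiM (insert d {..<d}) (\<lambda>_. unit_lborel)"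
    by (simp add: torus_def lessThan_Suc)
  have split: "(\<integral>\<^sup>+x. f x \<partial>torus (Suc d)) = (\<integral>\<^sup>+x. (\<integral>\<^sup>+y. f (x(d := y)) \<partial>unit_lborel) \<partial>torus d)"
    if "f \<in> borel_measurable (torus (Suc d))" for f
    unfolding ins torus_def[of d]
    by (rule product_nn_integral_insert) (use that in \<open>simp_all add: ins\<close>)
  have upd: "(\<lambda>(x, y). x(d := y)) \<in> measurable (torus d \<Otimes>\<^sub>M unit_lborel) (torus (Suc d))"
    unfolding ins unfolding torus_def by (rule measurable_add_dim)
  have g2: "(\<lambda>(x, y). g (x(d := y))) \<in> borel_measurable (torus d \<Otimes>\<^sub>M unit_lborel)"
    using measurable_compose[OF upd Suc.prems(2)] by (simp only: case_prod_unfold)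
  define h where "h x = (\<integral>\<^sup>+y. g (x(d := y)) \<partial>unit_lborel)" for x
  have h: "h \<in> borel_measurable (torus d)"
    unfolding h_def using sigma_finite_measure.borel_measurable_nn_integral_fst[OF prob_space_imp_sigma_finite[OF prob_space_unit_lborel] g2] by simp
  have step: "affine_map (Suc d) A b (x(d := y)) =
      (affine_map d A b x)(d := frac (y + ((\<Sum>i<d. x i * real_of_int (A i d)) + b d)))" for x y
    by (rule ext) (auto simp: affine_map_def last_row diag less_Suc_eq algebra_simps restrict_def)
  have "(\<integral>\<^sup>+x. g (affine_map (Suc d) A b x) \<partial>torus (Suc d)) =
    (\<integral>\<^sup>+x. (\<integral>\<^sup>+y. g (affine_map (Suc d) A b (x(d := y))) \<partial>unit_lborel) \<partial>torus d)"
    by (rule split) (rule measurable_compose[OF affine_map_measurable Suc.prems(2)])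
  also have "\<dots> = (\<integral>\<^sup>+x. h (affine_map d A b x) \<partial>torus d)"
  proof (rule nn_integral_cong)
    fix x assume x: "x \<in> space (torus d)"
    have Tx: "affine_map d A b x \<in> space (torus d)"
      using measurable_space[OF affine_map_measurable x] .
    have "(\<lambda>y. g ((affine_map d A b x)(d := y))) \<in> borel_measurable unit_lborel"
      using measurable_Pair2[OF g2 Tx] by simp
    from nn_integral_unit_lborel_shift[OF this]
    show "(\<integral>\<^sup>+y. g (affine_map (Suc d) A b (x(d := y))) \<partial>unit_lborel) = h (affine_map d A b x)"
      unfolding step h_def .
  qed
  also have "\<dots> = (\<integral>\<^sup>+x. h x \<partial>torus d)" by (rule Suc.IH[OF uni h])
  also have "\<dots> = (\<integral>\<^sup>+x. g x \<partial>torus (Suc d))" unfolding h_def by (rule split[symmetric]) (rule Suc.prems(2))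
  finally show ?case .
qed

lemma distr_affine_map:
  assumes "upper_unipotent d A"
  shows "distr (torus d) (torus d) (affine_map d A b) = torus d"
proof (rule measure_eqI)
  fix B assume "B \<in> sets (distr (torus d) (torus d) (affine_map d A b))"
  then have B [measurable]: "B \<in> sets (torus d)" by simp
  have "emeasure (distr (torus d) (torus d) (affine_map d A b)) B =
     (\<integral>\<^sup>+x. indicator B x \<partial>distr (torus d) (torus d) (affine_map d A b))" by simp
  also have "\<dots> = (\<integral>\<^sup>+x. indicator B (affine_map d A b x) \<partial>torus d)"
    by (rule nn_integral_distr) auto
  also have "\<dots> = (\<integral>\<^sup>+x. indicator B x \<partial>torus d)"
    by (rule nn_integral_affine_map[OF assms]) auto
  finally show "emeasure (distr (torus d) (torus d) (affine_map d A b)) B = emeasure (torus d) B" by simp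
qed simp

section \<open>A maximal ergodic theorem\<close>

locale measure_preserving = sigma_finite_measure M for M :: "'a measure" +
  fixes T :: "'a \<Rightarrow> 'a"
  assumes T_measurable [measurable]: "T \<in> measurable M M"
    and distr_T: "distr M M T = M"
begin

lemma T_space: "x \<in> space M \<Longrightarrow> T x \<in> space M"
  using measurable_space[OF T_measurable] .

lemma funpow_measurable [measurable]: "T ^^ n \<in> measurable M M"
  by (induction n) (auto intro: measurable_comp simp: measurable_ident id_def[symmetric])

lemma funpow_space: "x \<in> space M \<Longrightarrow> (T ^^ n) x \<in> space M"
  using measurable_space[OF funpow_measurable] .

lemma distr_funpow: "distr M M (T ^^ n) = M"
proof (induction n)
  case 0 then show ?case by (simp add: distr_id id_def)
next
  case (Suc n)
  have "distr M M (T ^^ Suc n) = distr (distr M M (T ^^ n)) M T"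
    by (subst distr_distr) auto
  then show ?case using Suc distr_T by (simp add: comp_def)
qed

lemma measure_funpow_vimage:
  assumes [measurable]: "B \<in> sets M"
  shows "measure M {x \<in> space M. (T ^^ n) x \<in> B} = measure M B"
proof -
  have "measure M B = measure (distr M M (T ^^ n)) B" by (simp add: distr_funpow)
  also have "\<dots> = measure M ((T ^^ n) -` B \<inter> space M)" by (rule measure_distr) auto
  also have "(T ^^ n) -` B \<inter> space M = {x \<in> space M. (T ^^ n) x \<in> B}" by auto
  finally show ?thesis by simp
qed

lemma integral_T:
  fixes f :: "'a \<Rightarrow> real"
  assumes "integrable M f"
  shows "integrable M (\<lambda>x. f (T x))" "(\<integral>x. f (T x) \<partial>M) = (\<integral>x. f x \<partial>M)"
  using assms integrable_distr[of T M M f] integral_distr[of T M M f] by (auto simp: distr_T)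

text \<open>The maximum of 0 and the partial orbit sums of \<open>f\<close> of length at most
  \<open>n\<close>, written as a recursion along \<open>T\<close> because Garsia's argument rests on
  that recursion.\<close>

primrec max_sum :: "('a \<Rightarrow> real) \<Rightarrow> nat \<Rightarrow> 'a \<Rightarrow> real" where
  "max_sum f 0 x = 0"
| "max_sum f (Suc n) x = max 0 (f x + max_sum f n (T x))"

lemma max_sum_nonneg: "0 \<le> max_sum f n x"
  by (cases n) auto

lemma max_sum_mono: "max_sum f n x \<le> max_sum f (Suc n) x"
proof (induction n arbitrary: x)
  case 0 show ?case by simp
next
  case (Suc n)
  show ?case using Suc[of "T x"] by (auto simp del: max_sum.simps(2) simp: max_sum.simps(2)[of f "Suc n"] max_sum.simps(2)[of f n])
qed

lemma incseq_max_sum: "incseq (\<lambda>n. max_sum f n x)"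
  by (rule incseq_SucI) (rule max_sum_mono)

lemma max_sum_ge: "(\<Sum>l<n. f ((T ^^ l) x)) \<le> max_sum f n x"
proof (induction n arbitrary: x)
  case (Suc n)
  have "(\<Sum>l<Suc n. f ((T ^^ l) x)) = f x + (\<Sum>l<n. f ((T ^^ l) (T x)))"
    by (simp only: sum.lessThan_Suc_shift funpow_Suc_right comp_def funpow_0)
  then show ?case using Suc[of "T x"] by simp
qed simp

lemma integrable_max_sum:
  assumes "integrable M f"
  shows "integrable M (max_sum f n)"
proof (induction n)
  case (Suc n)
  have "integrable M (\<lambda>x. max 0 (f x + max_sum f n (T x)))"
    using assms integral_T(1)[OF Suc] by (intro integrable_max) auto
  moreover have "max_sum f (Suc n) = (\<lambda>x. max 0 (f x + max_sum f n (T x)))" by (rule ext) simp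
  ultimately show ?case by simp
qed simp

text \<open>Where \<open>max_sum f n\<close> is positive, it is at most
  \<open>f x + max_sum f n (T x)\<close>; elsewhere it is 0 and hence at most its value at
  \<open>T x\<close>. The difference of the values at \<open>x\<close> and \<open>T x\<close> has
  integral 0 by invariance, so integration gives the claim.\<close>

lemma garsia:
  assumes f: "integrable M f"
  shows "0 \<le> (\<integral>x. f x * indicator {x \<in> space M. 0 < max_sum f n x} x \<partial>M)"
proof -
  have [measurable]: "max_sum f n \<in> borel_measurable M"
    using integrable_max_sum[OF f] by auto
  have int: "integrable M (\<lambda>x. f x * indicator {x \<in> space M. 0 < max_sum f n x} x)"
    by (rule integrable_real_mult_indicator) (use f in auto)
  have "0 = (\<integral>x. max_sum f n x - max_sum f n (T x) \<partial>M)"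
    using integral_T[OF integrable_max_sum[OF f, of n]] integrable_max_sum[OF f, of n] by simp
  also have "\<dots> \<le> (\<integral>x. f x * indicator {x \<in> space M. 0 < max_sum f n x} x \<partial>M)"
  proof (rule integral_mono)
    show "integrable M (\<lambda>x. max_sum f n x - max_sum f n (T x))"
      using integral_T(1)[OF integrable_max_sum[OF f, of n]] integrable_max_sum[OF f, of n] by simp
    fix x assume x: "x \<in> space M"
    show "max_sum f n x - max_sum f n (T x) \<le> f x * indicator {x \<in> space M. 0 < max_sum f n x} x"
    proof (cases n)
      case (Suc k)
      then show ?thesis
        using max_sum_mono[of f k "T x"] max_sum_nonneg[of f n "T x"] x by (auto simp: indicator_def)
    qed simp
  qed (rule int)
  finally show ?thesis .
qed

text \<open>The surplus of visits over \<open>\<eta> * N\<close> must be unbounded. One step more or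
  less along the orbit changes the surplus by a bounded amount, so membership is exactly
  \<open>T\<close>-invariant, and the countable quantifiers keep the set measurable.\<close>

definition often_visiting :: "real \<Rightarrow> 'a set \<Rightarrow> 'a set" where
  "often_visiting \<eta> F = {x \<in> space M. \<forall>c::nat. \<exists>N::nat. \<eta> * real N + real c < (\<Sum>l<N. indicator F ((T ^^ l) x))}"

lemma often_visiting_sets [measurable]:
  assumes [measurable]: "F \<in> sets M"
  shows "often_visiting \<eta> F \<in> sets M"
  unfolding often_visiting_def by measurable

lemma often_visiting_T:
  assumes "x \<in> space M" "0 \<le> \<eta>"
  shows "T x \<in> often_visiting \<eta> F \<longleftrightarrow> x \<in> often_visiting \<eta> F"
proof -
  define S where "S N x = (\<Sum>l<N. indicator F ((T ^^ l) x) :: real)" for N :: nat and x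
  have S: "S (Suc N) x = indicator F x + S N (T x)" for N
    unfolding S_def by (simp only: sum.lessThan_Suc_shift funpow_Suc_right comp_def funpow_0)
  have ind: "S N (T x) \<le> S (Suc N) x" "S (Suc N) x \<le> S N (T x) + 1" for N
    unfolding S by (auto simp: indicator_def)
  have "(\<forall>c::nat. \<exists>N::nat. \<eta> * real N + real c < S N (T x)) \<longleftrightarrow> (\<forall>c::nat. \<exists>N::nat. \<eta> * N + c < S N x)"
  proof (intro iffI allI)
    fix c :: nat
    assume *: "\<forall>c::nat. \<exists>N::nat. \<eta> * real N + real c < S N (T x)"
    obtain e :: nat where e: "\<eta> \<le> e" using real_arch_simple by blast
    obtain N :: nat where "\<eta> * N + real (c + e) < S N (T x)" using * by blast
    then have "\<eta> * Suc N + c < S (Suc N) x" using ind(1)[of N] e by (simp add: algebra_simps)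
    then show "\<exists>N::nat. \<eta> * N + c < S N x" by blast
  next
    fix c :: nat
    assume *: "\<forall>c::nat. \<exists>N::nat. \<eta> * real N + real c < S N x"
    obtain N :: nat where N: "\<eta> * N + real (c + 1) < S N x" using * by blast
    then have "N \<noteq> 0" by (auto simp: S_def intro: Nat.gr0I)
    then obtain N' where N': "N = Suc N'" by (cases N) auto
    have "\<eta> * N' + c < S N' (T x)" using N ind(2)[of N'] assms(2) by (simp add: N' algebra_simps)
    then show "\<exists>N::nat. \<eta> * N + c < S N (T x)" by blast
  qed
  then show ?thesis using assms T_space by (auto simp: often_visiting_def S_def)
qed

text \<open>A substitute for the pointwise ergodic theorem that also works in infinite measure spaces.\<close>

lemma emeasure_often_visiting:
  assumes F [measurable]: "F \<in> sets M" and fin: "emeasure M F < \<infinity>" and \<eta>: "0 < \<eta>"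
  shows "\<eta> * emeasure M (often_visiting \<eta> F) \<le> emeasure M F"
proof -
  let ?E = "often_visiting \<eta> F"
  \<comment> \<open>On a piece \<open>D\<close> of finite measure the function
    \<open>indicator F - \<eta> * indicator D\<close> is integrable, as Garsia's inequality demands;
    finiteness of the whole set is part of what is to be shown.\<close>
  have part: "\<eta> * measure M D \<le> measure M F"
    if D [measurable]: "D \<in> sets M" and DE: "D \<subseteq> ?E" and Dfin: "emeasure M D < \<infinity>" for D
  proof -
    define f where "f x = (indicator F x - \<eta> * indicator D x :: real)" for x
    have f: "integrable M f" unfolding f_def using fin Dfin by (intro Bochner_Integration.integrable_diff integrable_mult_right) auto
    define P where "P n = {x \<in> space M. 0 < max_sum f n x}" for n
    have [measurable]: "max_sum f n \<in> borel_measurable M" for n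
      using integrable_max_sum[OF f] by auto
    have P [measurable]: "P n \<in> sets M" for n unfolding P_def by measurable
    have bound: "\<eta> * measure M (D \<inter> P n) \<le> measure M F" for n
    proof -
      have "0 \<le> (\<integral>x. f x * indicator {x \<in> space M. 0 < max_sum f n x} x \<partial>M)" by (rule garsia[OF f])
      also have "\<dots> = (\<integral>x. indicator (F \<inter> P n) x - \<eta> * indicator (D \<inter> P n) x \<partial>M)"
        by (rule Bochner_Integration.integral_cong) (auto simp: f_def P_def indicator_def)
      also have "\<dots> = measure M (F \<inter> P n) - \<eta> * measure M (D \<inter> P n)"
      proof -
        have "emeasure M (F \<inter> P n) < \<infinity>" "emeasure M (D \<inter> P n) < \<infinity>"
          using le_less_trans[OF emeasure_mono fin, of "F \<inter> P n"]
            le_less_trans[OF emeasure_mono Dfin, of "D \<inter> P n"] by auto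
        then have "integrable M (indicat_real (F \<inter> P n))" "integrable M (indicat_real (D \<inter> P n))"
          by (auto intro: integrable_real_indicator)
        moreover have "F \<inter> P n \<inter> space M = F \<inter> P n" "D \<inter> P n \<inter> space M = D \<inter> P n"
          by (auto simp: P_def)
        ultimately show ?thesis by simp
      qed
      finally show ?thesis using measure_mono_fmeasurable[of "F \<inter> P n" F M] fin
        by (simp add: fmeasurable_def)
    qed
    have UN: "(\<Union>n. D \<inter> P n) = D"
    proof -
      have "\<exists>n. x \<in> P n" if "x \<in> D" for x
      proof -
        have xE: "x \<in> ?E" using that DE by auto
        then obtain N :: nat where "\<eta> * N + real 0 < (\<Sum>l<N. indicator F ((T ^^ l) x))"
          unfolding often_visiting_def by blast
        \<comment> \<open>Pointwise \<open>indicator F \<le> f + \<eta>\<close>, whether or not the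
          orbit is in \<open>D\<close> at that time, so a surplus of visits makes a partial sum of
          \<open>f\<close> positive.\<close>
        also have "(\<Sum>l<N. indicator F ((T ^^ l) x)) \<le> (\<Sum>l<N. f ((T ^^ l) x) + \<eta>)"
          unfolding f_def using \<eta> by (intro sum_mono) (auto simp: indicator_def)
        also have "\<dots> = (\<Sum>l<N. f ((T ^^ l) x)) + \<eta> * N" by (simp add: sum.distrib)
        finally have "0 < max_sum f N x" using max_sum_ge[of f x N] by simp
        then show ?thesis using xE by (auto simp: P_def often_visiting_def)
      qed
      then show ?thesis by auto
    qed
    have "incseq (\<lambda>n. D \<inter> P n)"
      using incseq_max_sum[of f] by (force simp: incseq_def P_def intro: less_le_trans)
    from Lim_measure_incseq[OF _ this] have "(\<lambda>n. measure M (D \<inter> P n)) \<longlonglongrightarrow> measure M D"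
      using Dfin UN by (auto simp: image_subset_iff)
    then have "(\<lambda>n. \<eta> * measure M (D \<inter> P n)) \<longlonglongrightarrow> \<eta> * measure M D" by (rule tendsto_mult_left)
    then show ?thesis by (rule LIMSEQ_le_const2) (use bound in auto)
  qed
  obtain A :: "nat \<Rightarrow> 'a set" where A: "range A \<subseteq> sets M" "(\<Union>i. A i) = space M"
      "\<And>i. emeasure M (A i) \<noteq> \<infinity>" "incseq A"
    using sigma_finite_incseq by blast
  have Aset [measurable]: "A i \<in> sets M" for i using A(1) by auto
  have "\<eta> * emeasure M (?E \<inter> A i) \<le> emeasure M F" for i
  proof -
    have fi: "emeasure M (?E \<inter> A i) < \<infinity>"
      using emeasure_mono[of "?E \<inter> A i" "A i" M] A(3)[of i] by (auto simp: less_top[symmetric] top_unique)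
    have "\<eta> * measure M (?E \<inter> A i) \<le> measure M F" by (rule part) (use fi in auto)
    then show ?thesis using fi fin \<eta>
      by (simp add: emeasure_eq_ennreal_measure less_top[symmetric] ennreal_mult'[symmetric])
  qed
  moreover have "emeasure M ?E = (SUP i. emeasure M (?E \<inter> A i))"
  proof (subst SUP_emeasure_incseq)
    show "incseq (\<lambda>i. ?E \<inter> A i)" using A(4) by (auto simp: incseq_def)
    have "(\<Union>i. ?E \<inter> A i) = ?E" using A(2) by (auto simp: often_visiting_def)
    then show "emeasure M ?E = emeasure M (\<Union>i. ?E \<inter> A i)" by simp
  qed auto
  ultimately show ?thesis by (simp add: SUP_mult_left_ennreal SUP_least)
qed

end

section \<open>Coboundaries from positive return frequency\<close>

locale ergodic_prob = prob_space M + measure_preserving M T for M :: "'a measure" and T +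
  assumes ergodic: "B \<in> sets M \<Longrightarrow> (\<And>x. x \<in> space M \<Longrightarrow> T x \<in> B \<longleftrightarrow> x \<in> B) \<Longrightarrow> measure M B = 0 \<or> measure M B = 1"

lemma emeasure_lborel_shift_vimage:
  assumes "B \<in> sets borel"
  shows "emeasure lborel {s :: real. s + a \<in> B} = emeasure lborel B"
proof -
  have "emeasure lborel B = emeasure (distr lborel borel (\<lambda>s. a + s)) B" by (simp add: lborel_distr_plus)
  also have "\<dots> = emeasure lborel {s. s + a \<in> B}"
    using assms by (subst emeasure_distr) (auto simp: vimage_def add.commute)
  finally show ?thesis by simp
qed

section \<open>Medians of sets of finite positive length\<close>

lemma Inf_translate:
  fixes S :: "real set"
  assumes "S \<noteq> {}" "bdd_below S"
  shows "Inf ((\<lambda>t. t + a) ` S) = Inf S + a"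
proof (rule antisym)
  have bdd: "bdd_below ((\<lambda>t. t + a) ` S)"
    using assms(2) by (intro bdd_belowI2[of _ "Inf S + a"]) (simp add: cInf_lower)
  have "Inf ((\<lambda>t. t + a) ` S) - a \<le> Inf S"
    using assms(1) cInf_lower[OF _ bdd] by (intro cInf_greatest) (auto simp: algebra_simps)
  then show "Inf ((\<lambda>t. t + a) ` S) \<le> Inf S + a" by simp
  show "Inf S + a \<le> Inf ((\<lambda>t. t + a) ` S)"
    using assms(1) cInf_lower[OF _ assms(2)] by (intro cInf_greatest) auto
qed

text \<open>The median serves as a canonical point of a fibre; the mean would not do, as a set of
  finite length may have no first moment.\<close>

definition lower_median :: "real set \<Rightarrow> real" where
  "lower_median B = Inf {t. emeasure lborel B \<le> 2 * emeasure lborel (B \<inter> {..t})}"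

context
  fixes B :: "real set"
  assumes B [measurable]: "B \<in> sets borel" and pos: "0 < emeasure lborel B" and fin: "emeasure lborel B < \<infinity>"
begin

lemma lower_median_set_nonempty: "{t. emeasure lborel B \<le> 2 * emeasure lborel (B \<inter> {..t})} \<noteq> {}"
proof
  assume "{t. emeasure lborel B \<le> 2 * emeasure lborel (B \<inter> {..t})} = {}"
  then have *: "2 * emeasure lborel (B \<inter> {..t}) \<le> emeasure lborel B" for t using linear by blast
  have "(\<lambda>n. emeasure lborel (B \<inter> {..real n})) \<longlonglongrightarrow> emeasure lborel (\<Union>n. B \<inter> {..real n})"
    by (rule Lim_emeasure_incseq) (auto simp: incseq_def)
  moreover have "(\<Union>n. B \<inter> {..real n}) = B" using real_arch_simple by auto
  ultimately have "(\<lambda>n. 2 * emeasure lborel (B \<inter> {..real n})) \<longlonglongrightarrow> 2 * emeasure lborel B"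
    by (intro ennreal_tendsto_cmult) auto
  then have "2 * emeasure lborel B \<le> emeasure lborel B" by (rule LIMSEQ_le_const2) (use * in auto)
  then have "emeasure lborel B + emeasure lborel B \<le> emeasure lborel B + 0" by (simp add: mult_2)
  then show False using pos fin by (subst (asm) ennreal_add_left_cancel_le) auto
qed

lemma lower_median_set_upward:
  assumes "emeasure lborel B \<le> 2 * emeasure lborel (B \<inter> {..t})" "t \<le> t'"
  shows "emeasure lborel B \<le> 2 * emeasure lborel (B \<inter> {..t'})"
  by (rule order_trans[OF assms(1)]) (use assms(2) in \<open>auto intro!: mult_left_mono emeasure_mono\<close>)

lemma lower_median_set_bdd_below: "bdd_below {t. emeasure lborel B \<le> 2 * emeasure lborel (B \<inter> {..t})}"
proof (rule ccontr)
  assume nb: "\<not> bdd_below {t. emeasure lborel B \<le> 2 * emeasure lborel (B \<inter> {..t})}"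
  have *: "emeasure lborel B \<le> 2 * emeasure lborel (B \<inter> {..- real n})" for n
  proof -
    obtain t where "emeasure lborel B \<le> 2 * emeasure lborel (B \<inter> {..t})" "t < - real n"
      using nb unfolding bdd_below_def by (metis (mono_tags, lifting) mem_Collect_eq not_le)
    then show ?thesis using lower_median_set_upward by auto
  qed
  have "(\<lambda>n. emeasure lborel (B \<inter> {..- real n})) \<longlonglongrightarrow> emeasure lborel (\<Inter>n. B \<inter> {..- real n})"
  proof (rule Lim_emeasure_decseq)
    show "emeasure lborel (B \<inter> {..- real n}) \<noteq> \<infinity>" for n
      using le_less_trans[OF emeasure_mono fin, of "B \<inter> {..- real n}"] by auto
  qed (auto simp: decseq_def)
  moreover have "(\<Inter>n. B \<inter> {..- real n}) = {}"
  proof -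
    have "\<exists>n. \<not> x \<le> - real n" for x using reals_Archimedean2[of "- x"] by (metis minus_less_iff not_le)
    then show ?thesis by auto
  qed
  ultimately have "(\<lambda>n. 2 * emeasure lborel (B \<inter> {..- real n})) \<longlonglongrightarrow> 2 * 0"
    by (intro ennreal_tendsto_cmult) auto
  then have "emeasure lborel B \<le> 2 * 0" by (rule LIMSEQ_le_const) (use * in auto)
  then show False using pos by simp
qed

text \<open>The admissible levels are upward closed, so a rational witness suffices. This turns the
  event \<open>lower_median B < c\<close> into a countable union, which is how medians of fibres are
  seen to be measurable.\<close>

lemma lower_median_less_iff:
  "lower_median B < c \<longleftrightarrow> (\<exists>q::rat. of_rat q < c \<and> emeasure lborel B \<le> 2 * emeasure lborel (B \<inter> {..of_rat q}))"
proof -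
  have "lower_median B < c \<longleftrightarrow> (\<exists>t<c. emeasure lborel B \<le> 2 * emeasure lborel (B \<inter> {..t}))"
    unfolding lower_median_def
    by (subst cInf_less_iff[OF lower_median_set_nonempty lower_median_set_bdd_below]) auto
  then show ?thesis using lower_median_set_upward of_rat_dense by (meson less_imp_le)
qed

lemma lower_median_shift: "lower_median ((\<lambda>s. s + a) ` B) = lower_median B + a"
proof -
  have im: "(\<lambda>s. s + a) ` S = {s. s + (- a) \<in> S}" for S :: "real set"
    by (force simp: image_iff)
  have B': "emeasure lborel ((\<lambda>s. s + a) ` B) = emeasure lborel B"
    unfolding im by (rule emeasure_lborel_shift_vimage) auto
  have Bt: "emeasure lborel ((\<lambda>s. s + a) ` B \<inter> {..t + a}) = emeasure lborel (B \<inter> {..t})" for t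
  proof -
    have "(\<lambda>s. s + a) ` B \<inter> {..t + a} = (\<lambda>s. s + a) ` (B \<inter> {..t})" by auto
    then show ?thesis unfolding im using emeasure_lborel_shift_vimage[of "B \<inter> {..t}" "- a"] by auto
  qed
  have "{t. emeasure lborel B \<le> 2 * emeasure lborel ((\<lambda>s. s + a) ` B \<inter> {..t})}
     = (\<lambda>t. t + a) ` {t. emeasure lborel B \<le> 2 * emeasure lborel (B \<inter> {..t})}" (is "?L = ?R")
  proof (intro set_eqI iffI)
    fix t assume "t \<in> ?L"
    then have "t - a \<in> {t. emeasure lborel B \<le> 2 * emeasure lborel (B \<inter> {..t})}"
      using Bt[of "t - a"] by simp
    then show "t \<in> ?R" by (rule rev_image_eqI) simp
  qed (auto simp: Bt)
  then show ?thesis unfolding lower_median_def B'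
    by (simp add: Inf_translate[OF lower_median_set_nonempty lower_median_set_bdd_below])
qed

end

section \<open>Skew products over an ergodic system\<close>

context ergodic_prob
begin

text \<open>Its iterates add the Birkhoff sums of \<open>\<phi>\<close> to the second coordinate, so
  the times at which these sums are bounded become visits to a strip of finite measure.\<close>

definition skew :: "('a \<Rightarrow> real) \<Rightarrow> 'a \<times> real \<Rightarrow> 'a \<times> real" where
  "skew \<phi> z = (T (fst z), snd z + \<phi> (fst z))"

lemma skew_funpow: "(skew \<phi> ^^ n) (x, s) = ((T ^^ n) x, s + (\<Sum>l<n. \<phi> ((T ^^ l) x)))"
  by (induction n) (auto simp: skew_def)

text \<open>Over \<open>x\<close>, the fibre of the preimage of \<open>B\<close> is a translate of
  the fibre of \<open>B\<close> over \<open>T x\<close>. Translation invariance in the fibre and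
  invariance of \<open>M\<close> in the base give the result by Tonelli.\<close>

lemma skew_measure_preserving:
  assumes [measurable]: "\<phi> \<in> borel_measurable M"
  shows "measure_preserving (M \<Otimes>\<^sub>M lborel) (skew \<phi>)"
proof -
  interpret P: pair_sigma_finite M lborel ..
  have [measurable]: "skew \<phi> \<in> measurable (M \<Otimes>\<^sub>M lborel) (M \<Otimes>\<^sub>M lborel)"
    unfolding skew_def by measurable
  have "distr (M \<Otimes>\<^sub>M lborel) (M \<Otimes>\<^sub>M lborel) (skew \<phi>) = M \<Otimes>\<^sub>M lborel"
  proof (rule measure_eqI)
    fix B assume "B \<in> sets (distr (M \<Otimes>\<^sub>M lborel) (M \<Otimes>\<^sub>M lborel) (skew \<phi>))"
    then have B [measurable]: "B \<in> sets (M \<Otimes>\<^sub>M lborel)" by (simp only: sets_distr)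
    have h: "(\<lambda>x. emeasure lborel (Pair x -` B)) \<in> borel_measurable M"
      using lborel.measurable_emeasure_Pair[OF B] .
    have "emeasure (distr (M \<Otimes>\<^sub>M lborel) (M \<Otimes>\<^sub>M lborel) (skew \<phi>)) B
      = emeasure (M \<Otimes>\<^sub>M lborel) (skew \<phi> -` B \<inter> space (M \<Otimes>\<^sub>M lborel))"
      by (rule emeasure_distr) (fact | simp)+
    also have "\<dots> = (\<integral>\<^sup>+x. emeasure lborel (Pair x -` (skew \<phi> -` B \<inter> space (M \<Otimes>\<^sub>M lborel))) \<partial>M)"
      by (rule lborel.emeasure_pair_measure_alt) measurable
    also have "\<dots> = (\<integral>\<^sup>+x. emeasure lborel (Pair (T x) -` B) \<partial>M)"
    proof (rule nn_integral_cong)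
      fix x assume x: "x \<in> space M"
      have "Pair x -` (skew \<phi> -` B \<inter> space (M \<Otimes>\<^sub>M lborel)) = {s. s + \<phi> x \<in> Pair (T x) -` B}"
        using x by (auto simp: skew_def space_pair_measure)
      then show "emeasure lborel (Pair x -` (skew \<phi> -` B \<inter> space (M \<Otimes>\<^sub>M lborel))) = emeasure lborel (Pair (T x) -` B)"
        using emeasure_lborel_shift_vimage[of "Pair (T x) -` B" "\<phi> x"] sets_Pair1[OF B, of "T x"] by simp
    qed
    also have "\<dots> = (\<integral>\<^sup>+x. emeasure lborel (Pair x -` B) \<partial>distr M M T)"
      by (rule nn_integral_distr[symmetric]) (use h in auto)
    also have "\<dots> = emeasure (M \<Otimes>\<^sub>M lborel) B"
      unfolding distr_T by (rule lborel.emeasure_pair_measure_alt[symmetric]) fact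
    finally show "emeasure (distr (M \<Otimes>\<^sub>M lborel) (M \<Otimes>\<^sub>M lborel) (skew \<phi>)) B = emeasure (M \<Otimes>\<^sub>M lborel) B" .
  qed simp
  then show ?thesis
    by (intro measure_preserving.intro measure_preserving_axioms.intro) (auto intro: P.sigma_finite_measure_axioms)
qed

text \<open>Equivariant fibres of finite positive length yield a transfer function: their medians.\<close>

lemma coboundary_of_invariant_set:
  assumes [measurable]: "\<phi> \<in> borel_measurable M"
    and E [measurable]: "E \<in> sets (M \<Otimes>\<^sub>M lborel)"
    and inv: "\<And>z. z \<in> space (M \<Otimes>\<^sub>M lborel) \<Longrightarrow> skew \<phi> z \<in> E \<longleftrightarrow> z \<in> E"
    and fin: "emeasure (M \<Otimes>\<^sub>M lborel) E < \<infinity>"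
    and pos: "0 < emeasure (M \<Otimes>\<^sub>M lborel) E"
  shows "\<exists>u \<in> borel_measurable M. AE x in M. \<phi> x = u (T x) - u x"
proof -
  define F where "F x = Pair x -` E" for x
  define m where "m x = emeasure lborel (F x)" for x
  have F [measurable]: "F x \<in> sets borel" for x
    using sets_Pair1[OF E] by (simp add: F_def)
  have m [measurable]: "m \<in> borel_measurable M"
    unfolding m_def[abs_def] F_def using lborel.measurable_emeasure_Pair[OF E] .
  have m_int: "emeasure (M \<Otimes>\<^sub>M lborel) E = (\<integral>\<^sup>+x. m x \<partial>M)"
    unfolding m_def F_def by (rule lborel.emeasure_pair_measure_alt) fact
  have F_T: "F (T x) = (\<lambda>s. s + \<phi> x) ` F x" if "x \<in> space M" for x
  proof -
    have *: "s + \<phi> x \<in> F (T x) \<longleftrightarrow> s \<in> F x" for s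
      using inv[of "(x, s)"] that by (simp add: F_def skew_def space_pair_measure)
    show ?thesis
    proof (intro set_eqI iffI)
      fix s assume "s \<in> F (T x)"
      then have "s - \<phi> x \<in> F x" using *[of "s - \<phi> x"] by simp
      then show "s \<in> (\<lambda>s. s + \<phi> x) ` F x" by (rule rev_image_eqI) simp
    qed (use * in auto)
  qed
  have m_T: "m (T x) = m x" if "x \<in> space M" for x
  proof -
    have "F (T x) = {s. s + (- \<phi> x) \<in> F x}"
      unfolding F_T[OF that] by (force simp: image_iff)
    then show ?thesis unfolding m_def using emeasure_lborel_shift_vimage[OF F, of "- \<phi> x" x] by simp
  qed
  \<comment> \<open>The fibre length \<open>m\<close> is \<open>T\<close>-invariant, so ergodicity
    applies to \<open>B\<close>. Since \<open>m\<close> has finite positive integral, it is finite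
    almost everywhere and \<open>B\<close> is not null; hence \<open>B\<close> has full
    measure.\<close>
  define B where "B = {x \<in> space M. 0 < m x \<and> m x < \<infinity>}"
  have B [measurable]: "B \<in> sets M" unfolding B_def by measurable
  have m_fin: "AE x in M. m x < \<infinity>"
    using nn_integral_PInf_AE[of m M] fin m_int by (auto simp: less_top)
  have "measure M B \<noteq> 0"
  proof
    assume "measure M B = 0"
    then have "AE x in M. x \<notin> B" using prob_eq_0[OF B] by simp
    then have "AE x in M. m x = 0" using m_fin AE_space
      by eventually_elim (auto simp: B_def not_less)
    then have "(\<integral>\<^sup>+x. m x \<partial>M) = 0" by (subst nn_integral_0_iff_AE) auto
    then show False using pos m_int by simp
  qed
  moreover have "measure M B = 0 \<or> measure M B = 1"
    by (rule ergodic[OF B]) (auto simp: B_def m_T T_space)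
  ultimately have B1: "AE x in M. x \<in> B" using prob_eq_1[OF B] by simp
  \<comment> \<open>The value 0 is a default on the null complement of \<open>B\<close>, where no
    median is available.\<close>
  define u where "u x = (if x \<in> B then lower_median (F x) else 0)" for x
  have u: "u \<in> borel_measurable M"
  proof (rule borel_measurableI_less)
    fix c
    have h [measurable]: "(\<lambda>x. emeasure lborel (F x \<inter> {..t})) \<in> borel_measurable M" for t
    proof -
      have h1: "(\<lambda>x. emeasure lborel (Pair x -` (E \<inter> (space M \<times> {..t})))) \<in> borel_measurable M"
        by (rule lborel.measurable_emeasure_Pair) measurable
      have h2: "emeasure lborel (Pair x -` (E \<inter> (space M \<times> {..t}))) = emeasure lborel (F x \<inter> {..t})"
        if "x \<in> space M" for x using that by (auto simp: F_def intro!: arg_cong[of _ _ "emeasure lborel"])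
      show ?thesis by (rule measurable_cong[THEN iffD1, OF h2 h1])
    qed
    have "{x \<in> space M. u x < c} = {x \<in> space M. (x \<in> B \<and> (\<exists>q::rat. of_rat q < c \<and> m x \<le> 2 * emeasure lborel (F x \<inter> {..of_rat q})))
       \<or> (x \<notin> B \<and> 0 < c)}"
    proof (rule Collect_cong, rule conj_cong[OF refl])
      fix x
      show "u x < c \<longleftrightarrow> (x \<in> B \<and> (\<exists>q::rat. of_rat q < c \<and> m x \<le> 2 * emeasure lborel (F x \<inter> {..of_rat q}))) \<or> (x \<notin> B \<and> 0 < c)"
      proof (cases "x \<in> B")
        case True
        then have "0 < emeasure lborel (F x)" "emeasure lborel (F x) < \<infinity>" by (simp_all add: B_def m_def)
        from lower_median_less_iff[OF F this] True show ?thesis by (simp add: u_def m_def)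
      qed (simp add: u_def)
    qed
    also have "\<dots> \<in> sets M" by measurable
    finally show "{x \<in> space M. u x < c} \<in> sets M" .
  qed
  have "AE x in M. \<phi> x = u (T x) - u x"
    using B1
  proof (rule AE_mp, intro AE_I2 impI)
    fix x assume x: "x \<in> space M" "x \<in> B"
    then have "T x \<in> B" by (simp add: B_def m_T T_space)
    moreover have "lower_median (F (T x)) = lower_median (F x) + \<phi> x"
      unfolding F_T[OF x(1)] using x(2) by (intro lower_median_shift) (auto simp: B_def m_def)
    ultimately show "\<phi> x = u (T x) - u x" using x(2) by (simp add: u_def)
  qed
  with u show ?thesis by blast
qed

text \<open>Cesaro means bounded below force, on a set \<open>X\<close> of positive measure, an
  unbounded surplus over \<open>\<eta> * N\<close> of times with Birkhoff sum in [-K,K]. Then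
  \<open>X \<times> {-1..1}\<close> lies in the invariant set of points often visiting a strip, and
  the maximal inequality bounds the measure of that set.\<close>

lemma coboundary_of_positive_density:
  fixes \<phi> :: "'a \<Rightarrow> real"
  assumes [measurable]: "\<phi> \<in> borel_measurable M" and c: "0 < c"
    and dens: "\<And>N. c * real N \<le> (\<Sum>l<N. prob {x \<in> space M. \<bar>\<Sum>i<l. \<phi> ((T ^^ i) x)\<bar> \<le> K})"
  shows "\<exists>u \<in> borel_measurable M. AE x in M. \<phi> x = u (T x) - u x"
proof -
  interpret P: pair_sigma_finite M lborel ..
  interpret S: measure_preserving "M \<Otimes>\<^sub>M lborel" "skew \<phi>"
    by (rule skew_measure_preserving) fact
  \<comment> \<open>A quarter of \<open>c\<close>: if the surplus were bounded almost everywhere,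
    the mean of \<open>G N\<close> would be at most \<open>\<eta> * N + m + \<eta> * N\<close>,
    hence below \<open>3 * \<eta> * N\<close> for large \<open>N\<close>, contradicting the lower
    bound \<open>c * N\<close>.\<close>
  define \<eta> where "\<eta> = c / 4"
  have \<eta>: "0 < \<eta>" using c by (simp add: \<eta>_def)
  define A where "A l = {x \<in> space M. \<bar>\<Sum>i<l. \<phi> ((T ^^ i) x)\<bar> \<le> K}" for l
  have A [measurable]: "A l \<in> sets M" for l unfolding A_def by measurable
  define G where "G N x = (\<Sum>l<N. indicator (A l) x :: real)" for N x
  define Y where "Y m = {x \<in> space M. \<forall>N. G N x \<le> \<eta> * real N + real m}" for m :: nat
  have G [measurable]: "G N \<in> borel_measurable M" for N unfolding G_def by measurable
  have Y [measurable]: "Y m \<in> sets M" for m unfolding Y_def by measurable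
  have G_le: "G N x \<le> real N" for N x
    using sum_mono[of "{..<N}" "\<lambda>l. indicator (A l) x :: real" "\<lambda>_. 1"] by (simp add: G_def indicator_def)
  have Y_lim: "prob (\<Union>m. Y m) < 1"
  proof (rule ccontr)
    assume "\<not> prob (\<Union>m. Y m) < 1"
    then have "1 - \<eta> < prob (\<Union>m. Y m)" using \<eta> by simp
    moreover have "(\<lambda>m. prob (Y m)) \<longlonglongrightarrow> prob (\<Union>m. Y m)"
    proof (rule finite_Lim_measure_incseq)
      show "incseq Y" unfolding incseq_def Y_def by (auto intro: order_trans)
    qed auto
    ultimately have "eventually (\<lambda>m. 1 - \<eta> < prob (Y m)) sequentially" by (rule order_tendstoD(1)[rotated])
    then obtain m where m: "1 - \<eta> < prob (Y m)" by (auto simp: eventually_sequentially)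
    obtain N :: nat where N: "real m / \<eta> < real N" using reals_Archimedean2 by blast
    then have mN: "real m < \<eta> * real N" using \<eta> by (simp add: field_simps)
    then have Npos: "0 < real N" using \<eta> by (smt (verit) mult_nonneg_nonpos of_nat_0_le_iff)
    have "c * real N \<le> (\<integral>x. G N x \<partial>M)"
      using dens[of N] unfolding G_def A_def[symmetric]
      by (subst Bochner_Integration.integral_sum)
        (auto intro!: integrable_real_indicator simp: less_top[symmetric] sets.Int_space_eq2)
    also have "\<dots> \<le> (\<integral>x. (\<eta> * real N + real m) + real N * indicator (space M - Y m) x \<partial>M)"
    proof (rule integral_mono)
      show "integrable M (G N)" unfolding G_def
        by (intro Bochner_Integration.integrable_sum integrable_real_indicator) (auto simp: less_top[symmetric])
      show "integrable M (\<lambda>x. (\<eta> * real N + real m) + real N * indicator (space M - Y m) x)"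
        by (intro Bochner_Integration.integrable_add integrable_mult_right integrable_real_indicator)
          (auto simp: less_top[symmetric])
      fix x assume "x \<in> space M"
      then show "G N x \<le> (\<eta> * real N + real m) + real N * indicator (space M - Y m) x"
        using G_le[of N x] \<eta> by (auto simp: Y_def indicator_def intro: order_trans[OF G_le])
    qed
    also have "\<dots> = (\<eta> * real N + real m) + real N * (1 - prob (Y m))"
    proof -
      have "integrable M (indicat_real (space M - Y m))"
        by (rule integrable_real_indicator) (auto simp: less_top[symmetric])
      then show ?thesis
        using prob_compl[OF Y, of m] by (subst Bochner_Integration.integral_add) (auto simp: prob_space)
    qed
    also have "\<dots> \<le> (\<eta> * real N + real m) + real N * \<eta>" using m by (intro add_left_mono mult_left_mono) auto
    also have "\<dots> < 3 * (\<eta> * real N)" using mN by simp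
    also have "\<dots> \<le> c * real N" using Npos c by (simp add: \<eta>_def)
    finally show False by simp
  qed
  define X where "X = space M - (\<Union>m. Y m)"
  have X [measurable]: "X \<in> sets M" unfolding X_def by measurable
  have X_pos: "0 < emeasure M X"
    using prob_compl[of "\<Union>m. Y m"] Y_lim by (simp add: X_def emeasure_eq_measure)
  \<comment> \<open>Enlarging [-K,K] by 1 on both sides allows for every starting height in
    [-1,1].\<close>
  define F where "F = space M \<times> {- K - 1..K + 1}"
  have F [measurable]: "F \<in> sets (M \<Otimes>\<^sub>M lborel)" unfolding F_def by measurable
  have F_fin: "emeasure (M \<Otimes>\<^sub>M lborel) F < \<infinity>"
    unfolding F_def by (subst lborel.emeasure_pair_measure_Times) (auto simp: emeasure_space_1 emeasure_lborel_Icc_eq)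
  define E where "E = S.often_visiting \<eta> F"
  have E [measurable]: "E \<in> sets (M \<Otimes>\<^sub>M lborel)" unfolding E_def by (rule S.often_visiting_sets) fact
  have XE: "X \<times> {-1..1} \<subseteq> E"
  proof safe
    fix x s assume x: "x \<in> X" and s: "s \<in> {-1..1::real}"
    have xs: "x \<in> space M" using x by (simp add: X_def)
    have "\<exists>N. \<eta> * real N + real k < (\<Sum>l<N. indicator F ((skew \<phi> ^^ l) (x, s)))" for k :: nat
    proof -
      obtain N where N: "\<eta> * real N + real k < G N x"
        using x by (auto simp: X_def Y_def not_le)
      also have "G N x \<le> (\<Sum>l<N. indicator F ((skew \<phi> ^^ l) (x, s)))"
        unfolding G_def using s xs
        by (intro sum_mono) (auto simp: skew_funpow A_def F_def indicator_def funpow_space)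
      finally show ?thesis by blast
    qed
    then show "(x, s) \<in> E"
      using xs by (auto simp: E_def S.often_visiting_def space_pair_measure)
  qed
  show ?thesis
  proof (rule coboundary_of_invariant_set[of \<phi> E])
    have "\<eta> * emeasure (M \<Otimes>\<^sub>M lborel) E \<le> emeasure (M \<Otimes>\<^sub>M lborel) F"
      unfolding E_def by (rule S.emeasure_often_visiting[OF F F_fin \<eta>])
    then have "ennreal \<eta> * emeasure (M \<Otimes>\<^sub>M lborel) E < \<infinity>" using F_fin by (rule le_less_trans)
    then show "emeasure (M \<Otimes>\<^sub>M lborel) E < \<infinity>" using \<eta> by (auto simp: ennreal_mult_less_top)
    have "0 < emeasure (M \<Otimes>\<^sub>M lborel) (X \<times> {-1..1::real})"
      using X_pos by (subst lborel.emeasure_pair_measure_Times) (auto simp: ennreal_zero_less_mult_iff)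
    also have "\<dots> \<le> emeasure (M \<Otimes>\<^sub>M lborel) E" by (rule emeasure_mono[OF XE E])
    finally show "0 < emeasure (M \<Otimes>\<^sub>M lborel) E" .
    show "skew \<phi> z \<in> E \<longleftrightarrow> z \<in> E" if "z \<in> space (M \<Otimes>\<^sub>M lborel)" for z
      unfolding E_def by (rule S.often_visiting_T[OF that]) (use \<eta> in simp)
  qed (use assms(1) E in auto)
qed

end

section \<open>Sampling trigonometric polynomials at roots of unity\<close>

text \<open>Interpolation in qualitative form: \<open>\<kappa>\<close> depends on the nodes
  \<open>Z\<close> only. When a node \<open>w\<close> is added, the quotient of q(z) - q(w) by z - w
  has smaller degree, and its values on \<open>Z\<close> are controlled because \<open>Z\<close>
  keeps a positive distance from \<open>w\<close>; multiplying back recovers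
  \<open>q\<close>.\<close>

lemma poly_bounded_by_sample:
  fixes Z :: "complex set"
  assumes "finite Z"
  shows "\<exists>\<kappa>\<ge>0. \<forall>q R. 0 \<le> R \<longrightarrow> degree q < card Z \<longrightarrow> (\<forall>z\<in>Z. norm (poly q z) \<le> R) \<longrightarrow>
     (\<forall>z. norm z = 1 \<longrightarrow> norm (poly q z) \<le> \<kappa> * R)"
  using assms
proof (induction Z)
  case empty
  show ?case by auto
next
  case (insert w Z)
  obtain \<kappa> where \<kappa>: "0 \<le> \<kappa>" and IH: "\<And>q R z. 0 \<le> R \<Longrightarrow> degree q < card Z \<Longrightarrow> (\<forall>z\<in>Z. norm (poly q z) \<le> R) \<Longrightarrow>
     norm z = 1 \<Longrightarrow> norm (poly q z) \<le> \<kappa> * R"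
    using insert.IH by blast
  define B where "B = (\<Sum>z\<in>Z. 1 / norm (z - w))"
  have B0: "0 \<le> B" unfolding B_def by (intro sum_nonneg) auto
  have B: "1 / norm (z - w) \<le> B" if "z \<in> Z" for z
    unfolding B_def using that insert.hyps by (intro member_le_sum) auto
  define \<kappa>' where "\<kappa>' = 1 + (1 + norm w) * \<kappa> * (2 * B)"
  have "0 \<le> \<kappa>'" using \<kappa> B0 by (auto simp: \<kappa>'_def)
  moreover have "norm (poly q z) \<le> \<kappa>' * R"
    if R: "0 \<le> R" and deg: "degree q < card (insert w Z)" and small: "\<forall>z\<in>insert w Z. norm (poly q z) \<le> R" and z: "norm z = 1"
    for q R z
  proof (cases "degree q = 0")
    \<comment> \<open>Constants are separated because their quotient again has degree 0, which is
      not below \<open>card Z\<close> when \<open>Z\<close> is empty.\<close>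
    case True
    then obtain a where "q = [:a:]" by (rule degree_eq_zeroE)
    then have "norm (poly q z) \<le> 1 * R" using small by auto
    also have "\<dots> \<le> \<kappa>' * R" unfolding \<kappa>'_def using \<kappa> B0 R by (intro mult_right_mono) auto
    finally show ?thesis .
  next
    case False
    define r where "r = synthetic_div q w"
    have q: "poly q y = (y - w) * poly r y + poly q w" for y
      using arg_cong[OF synthetic_div_correct'[of w q], of "\<lambda>p. poly p y"] by (simp add: r_def algebra_simps)
    have degr: "degree r < card Z" using deg False insert.hyps by (simp add: r_def degree_synthetic_div)
    have "norm (poly r y) \<le> 2 * B * R" if y: "y \<in> Z" for y
    proof -
      have yw: "norm (y - w) > 0" using y insert.hyps by auto
      have "norm (y - w) * norm (poly r y) = norm (poly q y - poly q w)"
        using q[of y] by (simp flip: norm_mult)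
      also have "\<dots> \<le> R + R"
        by (rule order_trans[OF norm_triangle_ineq4 add_mono]) (use small y in auto)
      finally have "norm (poly r y) \<le> (1 / norm (y - w)) * (2 * R)" using yw by (simp add: field_simps)
      also have "\<dots> \<le> B * (2 * R)" using B[OF y] R by (intro mult_right_mono) auto
      finally show ?thesis by simp
    qed
    then have rz: "norm (poly r z) \<le> \<kappa> * (2 * B * R)"
      using IH[of "2 * B * R" r z] R B0 degr z by auto
    have "norm (poly q z) \<le> norm (z - w) * norm (poly r z) + norm (poly q w)"
      by (subst q) (rule order_trans[OF norm_triangle_ineq], simp add: norm_mult)
    also have "\<dots> \<le> (1 + norm w) * (\<kappa> * (2 * B * R)) + R"
      using norm_triangle_ineq4[of z w] z rz small by (intro add_mono mult_mono) auto
    finally show ?thesis by (simp add: \<kappa>'_def algebra_simps)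
  qed
  ultimately show ?case by blast
qed

lemma sum_cis_roots_eq_0:
  fixes p :: int
  assumes "\<bar>p\<bar> < int M" "p \<noteq> 0"
  shows "(\<Sum>i<M. cis (2 * pi * of_int p * real i / real M)) = 0"
proof -
  have M: "0 < M" using assms by (cases M) auto
  define w where "w = cis (2 * pi * of_int p / real M)"
  have "w \<noteq> 1"
  proof
    assume "w = 1"
    then have "cos (2 * pi * of_int p / real M) = 1" by (simp add: w_def complex_eq_iff)
    then obtain n :: int where "2 * pi * of_int p / real M = of_int n * 2 * pi"
      by (auto simp: cos_one_2pi_int)
    then have "real_of_int p = of_int (n * int M)" using M by (simp add: field_simps)
    then have "p = n * int M" by linarith
    then have "n \<noteq> 0" "\<bar>p\<bar> = \<bar>n\<bar> * int M" using assms by (auto simp: abs_mult)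
    then have "int M \<le> \<bar>p\<bar>" using mult_right_mono[of 1 "\<bar>n\<bar>" "int M"] by auto
    then show False using assms by simp
  qed
  have "(\<Sum>i<M. cis (2 * pi * of_int p * real i / real M)) = (\<Sum>i<M. w ^ i)"
    by (intro sum.cong refl) (simp add: w_def Complex.DeMoivre mult_ac)
  also have "\<dots> = (w ^ M - 1) / (w - 1)" using \<open>w \<noteq> 1\<close> by (simp add: geometric_sum)
  also have "w ^ M = cis (2 * pi * of_int p)" using M by (simp add: w_def Complex.DeMoivre)
  also have "\<dots> = 1" using cis_multiple_2pi[of "of_int p"] by simp
  finally show ?thesis by simp
qed

text \<open>The constant term \<open>c\<close> is recovered as the mean over the \<open>M\<close>-th roots of unity,
  since all frequencies \<open>p k\<close> are nonzero.\<close>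

lemma trig_sum_small_values:
  fixes p :: "'k \<Rightarrow> int" and D M :: nat
  assumes K: "finite K" and p: "\<And>k. k \<in> K \<Longrightarrow> p k \<noteq> 0 \<and> \<bar>p k\<bar> \<le> int D" and DM: "D < M" and R: "0 \<le> R"
  shows "\<exists>\<kappa>. \<forall>a c. 2 * D < card {i. i < M \<and> norm ((\<Sum>k\<in>K. a k * cis (2 * pi * of_int (p k) * real i / real M)) - c) \<le> R}
     \<longrightarrow> norm (\<Sum>k\<in>K. a k) \<le> \<kappa>"
proof -
  define \<zeta> where "\<zeta> i = cis (2 * pi * real i / real M)" for i
  have M: "0 < M" using DM by simp
  have inj: "inj_on \<zeta> {..<M}"
    using Complex.bij_betw_roots_unity[OF M] by (auto simp: bij_betw_def \<zeta>_def[abs_def])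
  have "\<exists>\<kappa>\<ge>0. \<forall>q R. 0 \<le> R \<longrightarrow> degree q < card Z \<longrightarrow> (\<forall>z\<in>Z. norm (poly q z) \<le> R) \<longrightarrow>
     (\<forall>z. norm z = 1 \<longrightarrow> norm (poly q z) \<le> \<kappa> * R)" if "Z \<in> Pow (\<zeta> ` {..<M})" for Z
    using that by (intro poly_bounded_by_sample) (auto intro: finite_subset)
  then obtain \<kappa> where \<kappa>: "\<And>Z. Z \<in> Pow (\<zeta> ` {..<M}) \<Longrightarrow> 0 \<le> \<kappa> Z"
    and bound: "\<And>Z q R z. Z \<in> Pow (\<zeta> ` {..<M}) \<Longrightarrow> 0 \<le> R \<Longrightarrow> degree q < card Z \<Longrightarrow> (\<forall>z\<in>Z. norm (poly q z) \<le> R) \<Longrightarrow>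
     norm z = 1 \<Longrightarrow> norm (poly q z) \<le> \<kappa> Z * R"
    by metis
  \<comment> \<open>The set of good sample points varies with \<open>a\<close> and \<open>c\<close>.
    Summing over all subsets of the finitely many roots of unity gives one constant for all of
    them.\<close>
  define L where "L = (\<Sum>Z\<in>Pow (\<zeta> ` {..<M}). \<kappa> Z)"
  have L: "\<kappa> Z \<le> L" if "Z \<in> Pow (\<zeta> ` {..<M})" for Z
    unfolding L_def using that \<kappa> by (intro member_le_sum) auto
  have "norm (\<Sum>k\<in>K. a k) \<le> 2 * (L * R)"
    if many: "2 * D < card {i. i < M \<and> norm ((\<Sum>k\<in>K. a k * cis (2 * pi * of_int (p k) * real i / real M)) - c) \<le> R}" for a c
  proof -
    define I where "I = {i. i < M \<and> norm ((\<Sum>k\<in>K. a k * cis (2 * pi * of_int (p k) * real i / real M)) - c) \<le> R}"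
    \<comment> \<open>Multiplication by the \<open>D\<close>-th power of the unimodular
      \<open>\<zeta> i\<close> shifts the frequencies from [-D,D] to [0,2D], so up to a phase the
      values are those of a polynomial of degree at most \<open>2 * D\<close>.\<close>
    define q where "q = (\<Sum>k\<in>K. monom (a k) (nat (p k + int D))) - monom c D"
    have q_val: "norm (poly q (\<zeta> i)) = norm ((\<Sum>k\<in>K. a k * cis (2 * pi * of_int (p k) * real i / real M)) - c)" for i
    proof -
      have "\<zeta> i ^ nat (p k + int D) = \<zeta> i ^ D * cis (2 * pi * of_int (p k) * real i / real M)" if "k \<in> K" for k
      proof -
        have "real (nat (p k + int D)) = of_int (p k) + real D"
          using p[OF that] by linarith
        then show ?thesis
          unfolding \<zeta>_def Complex.DeMoivre by (simp add: cis_mult algebra_simps add_divide_distrib)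
      qed
      then have "poly q (\<zeta> i) = \<zeta> i ^ D * ((\<Sum>k\<in>K. a k * cis (2 * pi * of_int (p k) * real i / real M)) - c)"
        by (simp add: q_def poly_sum poly_monom sum_distrib_left algebra_simps)
      then show ?thesis by (simp add: norm_mult norm_power \<zeta>_def)
    qed
    have "degree q \<le> 2 * D"
      unfolding q_def
    proof (intro degree_diff_le degree_sum_le K)
      show "degree (monom (a k) (nat (p k + int D))) \<le> 2 * D" if "k \<in> K" for k
        using p[OF that] by (intro order_trans[OF degree_monom_le]) auto
      show "degree (monom c D) \<le> 2 * D" by (intro order_trans[OF degree_monom_le]) auto
    qed
    moreover have "card (\<zeta> ` I) = card I"
      by (rule card_image, rule inj_on_subset[OF inj]) (auto simp: I_def)
    ultimately have deg: "degree q < card (\<zeta> ` I)" using many by (simp add: I_def)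
    have sub: "\<zeta> ` I \<in> Pow (\<zeta> ` {..<M})" by (auto simp: I_def)
    have "norm (poly q (\<zeta> i)) \<le> L * R" for i
    proof -
      have "norm (poly q (\<zeta> i)) \<le> \<kappa> (\<zeta> ` I) * R"
      proof (rule bound[OF sub R deg])
        show "\<forall>z\<in>\<zeta> ` I. norm (poly q z) \<le> R"
          by (auto simp: q_val I_def)
      qed (simp add: \<zeta>_def)
      also have "\<dots> \<le> L * R" using L[OF sub] R by (intro mult_right_mono)
      finally show ?thesis .
    qed
    then have val: "norm ((\<Sum>k\<in>K. a k * cis (2 * pi * of_int (p k) * real i / real M)) - c) \<le> L * R" for i
      by (simp add: q_val)
    have "(\<Sum>i<M. (\<Sum>k\<in>K. a k * cis (2 * pi * of_int (p k) * real i / real M)) - c)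
      = (\<Sum>k\<in>K. a k * (\<Sum>i<M. cis (2 * pi * of_int (p k) * real i / real M))) - of_nat M * c"
      unfolding sum_subtractf sum_distrib_left by (subst sum.swap) simp
    also have "(\<Sum>k\<in>K. a k * (\<Sum>i<M. cis (2 * pi * of_int (p k) * real i / real M))) = 0"
    proof (rule sum.neutral, rule ballI)
      fix k assume "k \<in> K"
      from p[OF this] have "(\<Sum>i<M. cis (2 * pi * of_int (p k) * real i / real M)) = 0"
        by (intro sum_cis_roots_eq_0) (use DM in auto)
      then show "a k * (\<Sum>i<M. cis (2 * pi * of_int (p k) * real i / real M)) = 0" by simp
    qed
    finally have "real M * norm c = norm (\<Sum>i<M. (\<Sum>k\<in>K. a k * cis (2 * pi * of_int (p k) * real i / real M)) - c)"
      by (simp add: norm_mult)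
    also have "\<dots> \<le> (\<Sum>i<M. L * R)" by (rule sum_norm_le) (rule val)
    finally have c: "norm c \<le> L * R" using M by simp
    \<comment> \<open>The sample with index 0 is the wanted sum itself, minus
      \<open>c\<close>.\<close>
    have "norm ((\<Sum>k\<in>K. a k) - c) \<le> L * R" using val[of 0] by simp
    with c norm_triangle_ineq[of "(\<Sum>k\<in>K. a k) - c" c] show ?thesis by simp
  qed
  then show ?thesis by blast
qed

section \<open>Lifts to Euclidean space\<close>

text \<open>Without reduction modulo 1 the iterates are genuinely affine: moving the starting point
  by \<open>z\<close> moves the \<open>n\<close>-th iterate by the linear image of \<open>z\<close>,
  which \<open>frac\<close> would obscure.\<close>

definition affine_lift :: "nat \<Rightarrow> (nat \<Rightarrow> nat \<Rightarrow> int) \<Rightarrow> (nat \<Rightarrow> real) \<Rightarrow> (nat \<Rightarrow> real) \<Rightarrow> nat \<Rightarrow> real" where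
  "affine_lift d A b y = (\<lambda>j. (\<Sum>i<d. y i * of_int (A i j)) + b j)"

definition linear_lift :: "nat \<Rightarrow> (nat \<Rightarrow> nat \<Rightarrow> int) \<Rightarrow> (nat \<Rightarrow> real) \<Rightarrow> nat \<Rightarrow> real" where
  "linear_lift d A z = (\<lambda>j. \<Sum>i<d. z i * of_int (A i j))"

definition torus_cong :: "nat \<Rightarrow> (nat \<Rightarrow> real) \<Rightarrow> (nat \<Rightarrow> real) \<Rightarrow> bool" where
  "torus_cong d x y \<longleftrightarrow> (\<forall>j<d. x j - y j \<in> \<int>)"

lemma torus_cong_affine_map:
  assumes "torus_cong d x y"
  shows "torus_cong d (affine_map d A b x) (affine_lift d A b y)"
  unfolding torus_cong_def
proof (intro allI impI)
  fix j assume "j < d"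
  have "affine_map d A b x j - affine_lift d A b y j
    = (\<Sum>i<d. (x i - y i) * of_int (A i j)) - of_int \<lfloor>(\<Sum>i<d. x i * of_int (A i j)) + b j\<rfloor>"
    using \<open>j < d\<close> by (simp add: affine_map_def affine_lift_def frac_def sum_subtractf left_diff_distrib)
  moreover have "(\<Sum>i<d. (x i - y i) * of_int (A i j)) \<in> \<int>"
    using assms by (intro Ints_sum Ints_mult) (auto simp: torus_cong_def)
  ultimately show "affine_map d A b x j - affine_lift d A b y j \<in> \<int>" by (simp add: Ints_diff)
qed

lemma torus_cong_funpow:
  assumes "torus_cong d x y"
  shows "torus_cong d ((affine_map d A b ^^ n) x) ((affine_lift d A b ^^ n) y)"
  by (induction n) (use assms in \<open>auto intro: torus_cong_affine_map\<close>)

lemma affine_lift_funpow_add: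
  "(affine_lift d A b ^^ n) (\<lambda>j. y j + z j) = (\<lambda>j. (affine_lift d A b ^^ n) y j + (linear_lift d A ^^ n) z j)"
  by (induction n) (auto simp: affine_lift_def linear_lift_def sum.distrib distrib_right)

lemma linear_lift_funpow_scale:
  "(linear_lift d A ^^ n) (\<lambda>j. t * z j) = (\<lambda>j. t * (linear_lift d A ^^ n) z j)"
  by (induction n) (auto simp: linear_lift_def sum_distrib_left mult_ac)

lemma linear_lift_funpow_mat_pow:
  assumes "j < d"
  shows "(linear_lift d M ^^ n) w j = (\<Sum>i<d. w i * of_int (mat_pow d M n i j))"
  using assms
proof (induction n arbitrary: j)
  case 0
  have "(\<Sum>i<d. w i * of_int (id_mat i j)) = (\<Sum>i<d. if i = j then w i else 0)"
    by (intro sum.cong) (auto simp: id_mat_def)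
  with 0 show ?case by simp
next
  case (Suc n)
  have "(linear_lift d M ^^ Suc n) w j = (\<Sum>l<d. (\<Sum>i<d. w i * of_int (mat_pow d M n i l)) * of_int (M l j))"
    unfolding funpow.simps comp_def linear_lift_def[of d M "(linear_lift d M ^^ n) w"]
    by (intro sum.cong) (use Suc.IH in auto)
  also have "\<dots> = (\<Sum>i<d. w i * of_int (mat_pow d M (Suc n) i j))"
    unfolding sum_distrib_right by (subst sum.swap) (simp add: mat_mult_def sum_distrib_left mult_ac)
  finally show ?case .
qed

lemma linear_lift_minus_id:
  assumes "j < d"
  shows "linear_lift d A z j = z j + linear_lift d (minus_id A) z j"
proof -
  have "linear_lift d (minus_id A) z j = (\<Sum>i<d. z i * of_int (A i j) - (if i = j then z i else 0))"
    unfolding linear_lift_def by (intro sum.cong) (auto simp: minus_id_def id_mat_def algebra_simps)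
  with assms show ?thesis by (simp add: sum_subtractf linear_lift_def)
qed

text \<open>The binomial theorem for A = Id + (A - Id), by induction with Pascal's rule.\<close>

lemma linear_lift_funpow_binomial:
  assumes "j < d"
  shows "(linear_lift d A ^^ n) w j = (\<Sum>i\<le>n. of_nat (n choose i) * (linear_lift d (minus_id A) ^^ i) w j)"
  using assms
proof (induction n arbitrary: j)
  case 0 then show ?case by simp
next
  case (Suc n)
  define r where "r i = (linear_lift d (minus_id A) ^^ i) w" for i
  have "linear_lift d (minus_id A) ((linear_lift d A ^^ n) w) j = linear_lift d (minus_id A) (\<lambda>l. \<Sum>i\<le>n. of_nat (n choose i) * r i l) j"
    unfolding linear_lift_def[of d "minus_id A"] by (intro sum.cong) (use Suc.IH in \<open>auto simp: r_def\<close>)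
  also have "\<dots> = (\<Sum>i\<le>n. of_nat (n choose i) * r (Suc i) j)"
    unfolding linear_lift_def[of d "minus_id A"] sum_distrib_right
    by (subst sum.swap) (simp add: r_def linear_lift_def sum_distrib_left mult_ac)
  finally have "(linear_lift d A ^^ Suc n) w j = (\<Sum>i\<le>n. of_nat (n choose i) * r i j) + (\<Sum>i\<le>n. of_nat (n choose i) * r (Suc i) j)"
    using Suc.IH[OF Suc.prems] linear_lift_minus_id[OF Suc.prems, of A "(linear_lift d A ^^ n) w"] by (simp add: r_def)
  also have "(\<Sum>i\<le>n. of_nat (n choose i) * r i j) = (\<Sum>i\<le>Suc n. of_nat (n choose i) * r i j)"
    by (simp add: binomial_eq_0)
  also have "\<dots> = r 0 j + (\<Sum>i\<le>n. of_nat (n choose Suc i) * r (Suc i) j)"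
    by (subst sum.atMost_Suc_shift) simp
  also have "\<dots> + (\<Sum>i\<le>n. of_nat (n choose i) * r (Suc i) j) = (\<Sum>i\<le>Suc n. of_nat (Suc n choose i) * r i j)"
    by (subst sum.atMost_Suc_shift[where g = "\<lambda>i. of_nat (Suc n choose i) * r i j"])
      (simp add: sum.distrib algebra_simps)
  finally show ?case by (simp add: r_def)
qed

text \<open>Makes the lower terms in the binomial expansion of A^n negligible against the leading
  one: \<open>n choose i\<close> is at most n^(k-1), while \<open>n choose k\<close> is at least
  (n/k)^k.\<close>

lemma binomial_ratio_tendsto_0:
  assumes "i < k"
  shows "(\<lambda>n. real (n choose i) / real (n choose k)) \<longlonglongrightarrow> 0"
proof (rule tendsto_sandwich[OF _ _ tendsto_const])
  have bound: "real (n choose i) / real (n choose k) \<le> real k ^ k * (1 / real n)" if n: "max k 1 \<le> n" for n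
  proof -
    have n1: "1 \<le> real n" "k \<le> n" using n by auto
    have "real (n choose i) \<le> real n ^ i"
      using binomial_le_pow[of i n] assms n by (simp flip: of_nat_power)
    also have "\<dots> \<le> real n ^ (k - 1)" using assms n1 by (intro power_increasing) auto
    finally have 1: "real (n choose i) \<le> real n ^ (k - 1)" .
    have 2: "(real n / real k) ^ k \<le> real (n choose k)" by (rule binomial_ge_n_over_k_pow_k[OF n1(2)])
    have pos: "0 < (real n / real k) ^ k" using assms n1 by auto
    have "real (n choose i) / real (n choose k) \<le> real n ^ (k - 1) / (real n / real k) ^ k"
      by (intro frac_le 1 2 pos) auto
    also have "\<dots> = real k ^ k * (1 / real n)"
      using assms n1 by (cases k) (auto simp: power_divide field_simps)
    finally show ?thesis .
  qed
  then show "eventually (\<lambda>n. real (n choose i) / real (n choose k) \<le> real k ^ k * (1 / real n)) sequentially"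
    unfolding eventually_sequentially by blast
  show "(\<lambda>n. real k ^ k * (1 / real n)) \<longlonglongrightarrow> 0"
    by (intro tendsto_mult_right_zero lim_1_over_n)
qed auto

lemma norm_cis_diff_le: "norm (cis a - cis b) \<le> \<bar>a - b\<bar>"
proof -
  have "cis a - cis b = cis b * (iexp (a - b) - 1)"
    by (simp add: cis_conv_exp algebra_simps exp_diff)
  then show ?thesis using iexp_approx1[of "a - b" 0] by (simp add: norm_mult)
qed

section \<open>Trigonometric sums on the torus\<close>

definition trig_sum :: "nat \<Rightarrow> (nat \<Rightarrow> int) set \<Rightarrow> ((nat \<Rightarrow> int) \<Rightarrow> complex) \<Rightarrow> (nat \<Rightarrow> real) \<Rightarrow> complex" where
  "trig_sum d K c y = (\<Sum>k\<in>K. c k * cis (2 * pi * (\<Sum>i<d. of_int (k i) * y i)))"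

lemma trig_sum_torus_cong:
  assumes "torus_cong d x y"
  shows "trig_sum d K c x = trig_sum d K c y"
proof -
  have "cis (2 * pi * (\<Sum>i<d. of_int (k i) * x i)) = cis (2 * pi * (\<Sum>i<d. of_int (k i) * y i))" for k
  proof -
    have "(\<Sum>i<d. of_int (k i) * (x i - y i)) \<in> \<int>"
      using assms by (intro Ints_sum Ints_mult) (auto simp: torus_cong_def)
    then have "cis (2 * pi * (\<Sum>i<d. of_int (k i) * (x i - y i))) = 1" by (rule cis_multiple_2pi)
    moreover have "2 * pi * (\<Sum>i<d. of_int (k i) * x i) = 2 * pi * (\<Sum>i<d. of_int (k i) * y i) + 2 * pi * (\<Sum>i<d. of_int (k i) * (x i - y i))"
      by (simp add: right_diff_distrib sum_subtractf)
    ultimately show ?thesis by (simp flip: cis_mult)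
  qed
  then show ?thesis by (simp add: trig_sum_def)
qed

lemma trig_sum_lipschitz:
  "\<exists>L\<ge>0. \<forall>y y'. norm (trig_sum d K c y - trig_sum d K c y') \<le> L * (\<Sum>j<d. \<bar>y j - y' j\<bar>)"
proof -
  define L where "L = (\<Sum>k\<in>K. norm (c k) * (2 * pi * (\<Sum>i<d. \<bar>real_of_int (k i)\<bar>)))"
  have "norm (trig_sum d K c y - trig_sum d K c y') \<le> L * (\<Sum>j<d. \<bar>y j - y' j\<bar>)" for y y'
  proof -
    have "norm (trig_sum d K c y - trig_sum d K c y') = norm (\<Sum>k\<in>K. c k * (cis (2 * pi * (\<Sum>i<d. of_int (k i) * y i)) - cis (2 * pi * (\<Sum>i<d. of_int (k i) * y' i))))"
      by (simp add: trig_sum_def sum_subtractf right_diff_distrib)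
    also have "\<dots> \<le> (\<Sum>k\<in>K. norm (c k) * (2 * pi * (\<Sum>i<d. \<bar>real_of_int (k i)\<bar>)) * (\<Sum>j<d. \<bar>y j - y' j\<bar>))"
    proof (rule sum_norm_le)
      fix k assume "k \<in> K"
      have "norm (cis (2 * pi * (\<Sum>i<d. of_int (k i) * y i)) - cis (2 * pi * (\<Sum>i<d. of_int (k i) * y' i)))
         \<le> \<bar>2 * pi * (\<Sum>i<d. of_int (k i) * y i) - 2 * pi * (\<Sum>i<d. of_int (k i) * y' i)\<bar>"
        by (rule norm_cis_diff_le)
      also have "\<dots> = 2 * pi * \<bar>\<Sum>i<d. of_int (k i) * (y i - y' i)\<bar>"
      proof -
        have "2 * pi * (\<Sum>i<d. of_int (k i) * y i) - 2 * pi * (\<Sum>i<d. of_int (k i) * y' i)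
          = 2 * pi * (\<Sum>i<d. of_int (k i) * (y i - y' i))"
          by (simp add: sum_subtractf right_diff_distrib)
        then show ?thesis by (simp only: abs_mult) simp
      qed
      also have "\<dots> \<le> 2 * pi * (\<Sum>i<d. \<bar>real_of_int (k i)\<bar> * (\<Sum>j<d. \<bar>y j - y' j\<bar>))"
        by (intro mult_left_mono order_trans[OF sum_abs] sum_mono)
          (auto simp: abs_mult intro!: mult_left_mono member_le_sum[of _ _ "\<lambda>j. \<bar>y j - y' j\<bar>"])
      finally show "norm (c k * (cis (2 * pi * (\<Sum>i<d. of_int (k i) * y i)) - cis (2 * pi * (\<Sum>i<d. of_int (k i) * y' i))))
        \<le> norm (c k) * (2 * pi * (\<Sum>i<d. \<bar>real_of_int (k i)\<bar>)) * (\<Sum>j<d. \<bar>y j - y' j\<bar>)"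
        by (simp add: norm_mult sum_distrib_right mult.assoc mult_left_mono)
    qed
    also have "\<dots> = L * (\<Sum>j<d. \<bar>y j - y' j\<bar>)" by (simp add: L_def sum_distrib_right)
    finally show ?thesis .
  qed
  moreover have "0 \<le> L" unfolding L_def by (intro sum_nonneg mult_nonneg_nonneg) auto
  ultimately show ?thesis by blast
qed

lemma affine_lift_funpow_lipschitz:
  "\<exists>L\<ge>0. \<forall>y y'. (\<Sum>j<d. \<bar>(affine_lift d A b ^^ n) y j - (affine_lift d A b ^^ n) y' j\<bar>) \<le> L * (\<Sum>j<d. \<bar>y j - y' j\<bar>)"
proof (induction n)
  case 0 show ?case by (intro exI[of _ 1]) auto
next
  case (Suc n)
  then obtain L where L: "0 \<le> L" "\<And>y y'. (\<Sum>j<d. \<bar>(affine_lift d A b ^^ n) y j - (affine_lift d A b ^^ n) y' j\<bar>) \<le> L * (\<Sum>j<d. \<bar>y j - y' j\<bar>)"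
    by blast
  define L' where "L' = (\<Sum>j<d. \<Sum>i<d. \<bar>real_of_int (A i j)\<bar>)"
  have step: "(\<Sum>j<d. \<bar>affine_lift d A b u j - affine_lift d A b v j\<bar>) \<le> L' * (\<Sum>j<d. \<bar>u j - v j\<bar>)" for u v
  proof -
    have "\<bar>affine_lift d A b u j - affine_lift d A b v j\<bar> \<le> (\<Sum>i<d. \<bar>real_of_int (A i j)\<bar>) * (\<Sum>j<d. \<bar>u j - v j\<bar>)" for j
    proof -
      have "affine_lift d A b u j - affine_lift d A b v j = (\<Sum>i<d. of_int (A i j) * (u i - v i))"
        by (simp add: affine_lift_def sum_subtractf algebra_simps)
      also have "\<bar>\<dots>\<bar> \<le> (\<Sum>i<d. \<bar>real_of_int (A i j)\<bar> * (\<Sum>j<d. \<bar>u j - v j\<bar>))"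
        by (intro order_trans[OF sum_abs] sum_mono)
          (auto simp: abs_mult intro!: mult_left_mono member_le_sum[of _ _ "\<lambda>j. \<bar>u j - v j\<bar>"])
      finally show ?thesis by (simp add: sum_distrib_right)
    qed
    then show ?thesis unfolding L'_def sum_distrib_right[of _ "{..<d}" "\<Sum>j<d. \<bar>u j - v j\<bar>"] by (intro sum_mono) auto
  qed
  have L'0: "0 \<le> L'" unfolding L'_def by (intro sum_nonneg) auto
  have "(\<Sum>j<d. \<bar>(affine_lift d A b ^^ Suc n) y j - (affine_lift d A b ^^ Suc n) y' j\<bar>) \<le> (L' * L) * (\<Sum>j<d. \<bar>y j - y' j\<bar>)" for y y'
    using order_trans[OF step mult_left_mono[OF L(2) L'0]] by (simp add: mult.assoc)
  then show ?case using L(1) L'0 by (intro exI[of _ "L' * L"]) auto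
qed

text \<open>Modes with vanishing last frequency are the ones that survive integration over the last
  coordinate. Their sum is therefore that integral, which is 0, and they can be discarded.\<close>

lemma trig_sum_Qd:
  assumes d: "0 < d" and "\<Psi> \<in> Qd d"
  shows "\<exists>K c. finite K \<and> (\<forall>k\<in>K. k (d - 1) \<noteq> 0) \<and> \<Psi> = trig_sum d K c"
proof -
  obtain K c where K: "finite K" and \<Psi>: "\<And>x. \<Psi> x = (\<Sum>k\<in>K. c k * exp (2 * of_real pi * \<i> * of_real (\<Sum>i<d. real_of_int (k i) * x i)))"
    using assms unfolding Qd_def trig_poly_def by blast
  have \<Psi>': "\<Psi> = trig_sum d K c"
    by (rule ext) (simp add: \<Psi> trig_sum_def cis_conv_exp mult_ac)
  define K0 where "K0 = {k \<in> K. k (d - 1) = 0}"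
  define K1 where "K1 = {k \<in> K. k (d - 1) \<noteq> 0}"
  have zero: "trig_sum d K0 c x = 0" for x
  proof -
    define a where "a k = c k * cis (2 * pi * (\<Sum>i<d-1. of_int (k i) * x i))" for k
    define p where "p k = 2 * pi * real_of_int (k (d - 1))" for k :: "nat \<Rightarrow> int"
    have val: "trig_sum d K' c (x(d - 1 := t)) = (\<Sum>k\<in>K'. a k * cis (p k * t))" for K' t
    proof -
      have "(\<Sum>i<d. of_int (k i) * (x(d - 1 := t)) i) = (\<Sum>i<d-1. of_int (k i) * x i) + of_int (k (d - 1)) * t" for k :: "nat \<Rightarrow> int"
        using d by (cases d) auto
      then show ?thesis by (simp add: trig_sum_def a_def p_def distrib_left mult.assoc flip: cis_mult)
    qed
    \<comment> \<open>An explicit antiderivative along the last coordinate. Modes of nonzero last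
      frequency are 1-periodic and cancel in \<open>F 1 - F 0\<close>, which leaves those in
      \<open>K0\<close>.\<close>
    define F where "F t = (\<Sum>k\<in>K. if k (d - 1) = 0 then a k * of_real t else a k * cis (p k * t) / (\<i> * of_real (p k)))" for t
    have "(LBINT t=ereal 0..ereal 1. trig_sum d K c (x(d - 1 := t))) = F 1 - F 0"
    proof (rule interval_integral_FTC_finite)
      show "continuous_on {min 0 1..max 0 1} (\<lambda>t. trig_sum d K c (x(d - 1 := t)))"
        unfolding val cis_conv_exp by (intro continuous_intros)
      fix t :: real
      have "((\<lambda>t. if k (d - 1) = 0 then a k * of_real t else a k * cis (p k * t) / (\<i> * of_real (p k)))
         has_vector_derivative a k * cis (p k * t)) (at t within S)" for k S
      proof (cases "k (d - 1) = 0")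
        case True
        have "((\<lambda>t. a k * of_real t) has_vector_derivative a k * of_real 1) (at t within S)"
          by (intro derivative_intros)
        then show ?thesis using True by (simp add: p_def)
      next
        case False
        then have p0: "p k \<noteq> 0" by (simp add: p_def)
        have "((\<lambda>t. exp (of_real t * (\<i> * of_real (p k)))) has_vector_derivative (\<i> * of_real (p k)) * exp (of_real t * (\<i> * of_real (p k)))) (at t within S)"
          using exp_scaleR_has_vector_derivative_right[of "\<i> * of_real (p k)" t S]
          by (simp add: scaleR_conv_of_real mult_ac)
        from has_vector_derivative_mult_right[OF this, of "a k / (\<i> * of_real (p k))"]
        show ?thesis using False p0 by (simp add: cis_conv_exp mult_ac)
      qed
      then show "(F has_vector_derivative trig_sum d K c (x(d - 1 := t))) (at t within {min 0 1..max 0 1})"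
        unfolding val F_def by (intro derivative_intros)
    qed
    moreover have "(LBINT t=0..1. \<Psi> (x(d - 1 := t))) = 0" using assms(2) by (simp add: Qd_def)
    ultimately have "F 1 - F 0 = 0" by (simp add: \<Psi>' zero_ereal_def one_ereal_def)
    moreover have "F 1 - F 0 = (\<Sum>k\<in>K. if k (d - 1) = 0 then a k else 0)"
    proof -
      have "cis (p k) = 1" for k unfolding p_def by (rule cis_multiple_2pi) simp
      then show ?thesis unfolding F_def sum_subtractf[symmetric] by (intro sum.cong) auto
    qed
    moreover have "\<dots> = (\<Sum>k\<in>K0. a k)" unfolding K0_def by (rule sum.inter_filter[OF K, symmetric])
    moreover have "\<dots> = trig_sum d K0 c (x(d - 1 := x (d - 1)))" unfolding val by (intro sum.cong) (auto simp: K0_def p_def)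
    ultimately show ?thesis by simp
  qed
  have "trig_sum d K c = trig_sum d K1 c"
  proof (rule ext)
    fix x
    have "trig_sum d K c x = trig_sum d K0 c x + trig_sum d K1 c x"
      unfolding trig_sum_def using K by (subst sum.union_disjoint[symmetric]) (auto simp: K0_def K1_def intro!: sum.cong)
    then show "trig_sum d K c x = trig_sum d K1 c x" by (simp add: zero)
  qed
  then show ?thesis using K \<Psi>' by (intro exI[of _ K1] exI[of _ c]) (auto simp: K1_def)
qed

section \<open>Decoupling\<close>

lemma trig_sum_measurable: "trig_sum d K c \<in> borel_measurable (torus d)"
proof -
  have "(\<lambda>x. \<Sum>i<d. of_int (k i) * x i) \<in> borel_measurable (torus d)" for k :: "nat \<Rightarrow> int"
    by (intro borel_measurable_sum borel_measurable_times torus_component_measurable borel_measurable_const) auto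
  then have "(\<lambda>x. 2 * pi * (\<Sum>i<d. of_int (k i) * x i)) \<in> borel_measurable (torus d)" for k :: "nat \<Rightarrow> int"
    by (rule borel_measurable_times[OF borel_measurable_const])
  from measurable_compose[OF this borel_measurable_continuous_onI[OF continuous_on_cis[OF continuous_on_id]]]
  have "(\<lambda>x. cis (2 * pi * (\<Sum>i<d. of_int (k i) * x i))) \<in> borel_measurable (torus d)" for k :: "nat \<Rightarrow> int" .
  then show ?thesis
    unfolding trig_sum_def[abs_def] by (intro borel_measurable_sum borel_measurable_times borel_measurable_const)
qed

section \<open>Birkhoff sums and their lifts\<close>

lemma birkhoff_sum_measurable:
  assumes "T \<in> measurable M M" "\<Phi> \<in> borel_measurable M"
  shows "birkhoff_sum T n \<Phi> \<in> borel_measurable M"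
proof -
  have "T ^^ i \<in> measurable M M" for i
    by (induction i) (use assms(1) in \<open>auto intro: measurable_comp simp: id_def[symmetric]\<close>)
  then show ?thesis
    unfolding birkhoff_sum_def[abs_def] by (intro borel_measurable_sum measurable_compose[OF _ assms(2)])
qed

lemma birkhoff_sum_add: "birkhoff_sum T (m + n) \<Phi> x = birkhoff_sum T m \<Phi> x + birkhoff_sum T n \<Phi> ((T ^^ m) x)"
proof -
  have "(T ^^ (m + i)) x = (T ^^ i) ((T ^^ m) x)" for i
    using funpow_add[of i m T] by (simp add: add.commute)
  then show ?thesis by (induction n) (simp_all add: birkhoff_sum_def)
qed

text \<open>The sum of length \<open>n + l\<close> is split in both orders. The sum over the long
  time \<open>n\<close> is thereby traded for one over the fixed time \<open>l\<close>, evaluated at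
  time \<open>n\<close>.\<close>

lemma birkhoff_sum_commute:
  "birkhoff_sum T n \<Phi> ((T ^^ l) x) - birkhoff_sum T n \<Phi> x = birkhoff_sum T l \<Phi> ((T ^^ n) x) - birkhoff_sum T l \<Phi> x"
  using birkhoff_sum_add[of T n l \<Phi> x] birkhoff_sum_add[of T l n \<Phi> x] by (simp add: add.commute algebra_simps)

lemma birkhoff_sum_lift:
  assumes "torus_cong d x y"
  shows "birkhoff_sum (affine_map d A b) l (trig_sum d K c) x = (\<Sum>q<l. trig_sum d K c ((affine_lift d A b ^^ q) y))"
  unfolding birkhoff_sum_def by (intro sum.cong refl trig_sum_torus_cong torus_cong_funpow assms)

text \<open>The constant may depend on \<open>l\<close>: it is fixed before \<open>n\<close> tends
  to infinity, while the displacements it multiplies tend to 0.\<close>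

lemma birkhoff_lift_lipschitz:
  "\<exists>L\<ge>0. \<forall>y y'. norm ((\<Sum>q<l. trig_sum d K c ((affine_lift d A b ^^ q) y)) - (\<Sum>q<l. trig_sum d K c ((affine_lift d A b ^^ q) y')))
     \<le> L * (\<Sum>j<d. \<bar>y j - y' j\<bar>)"
proof -
  obtain L where L: "0 \<le> L" "\<And>y y'. norm (trig_sum d K c y - trig_sum d K c y') \<le> L * (\<Sum>j<d. \<bar>y j - y' j\<bar>)"
    using trig_sum_lipschitz by blast
  have "\<exists>N\<ge>0. \<forall>y y'. (\<Sum>j<d. \<bar>(affine_lift d A b ^^ q) y j - (affine_lift d A b ^^ q) y' j\<bar>) \<le> N * (\<Sum>j<d. \<bar>y j - y' j\<bar>)" for q
    by (rule affine_lift_funpow_lipschitz)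
  then obtain N where N: "\<And>q. 0 \<le> N q"
    "\<And>q y y'. (\<Sum>j<d. \<bar>(affine_lift d A b ^^ q) y j - (affine_lift d A b ^^ q) y' j\<bar>) \<le> N q * (\<Sum>j<d. \<bar>y j - y' j\<bar>)"
    by metis
  have "norm ((\<Sum>q<l. trig_sum d K c ((affine_lift d A b ^^ q) y)) - (\<Sum>q<l. trig_sum d K c ((affine_lift d A b ^^ q) y')))
     \<le> (\<Sum>q<l. L * N q) * (\<Sum>j<d. \<bar>y j - y' j\<bar>)" for y y'
    unfolding sum_subtractf[symmetric] sum_distrib_right
  proof (rule sum_norm_le)
    fix q
    show "norm (trig_sum d K c ((affine_lift d A b ^^ q) y) - trig_sum d K c ((affine_lift d A b ^^ q) y')) \<le> L * N q * (\<Sum>j<d. \<bar>y j - y' j\<bar>)"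
      using order_trans[OF L(2) mult_left_mono[OF N(2) L(1)]] by (simp add: mult.assoc)
  qed
  moreover have "0 \<le> (\<Sum>q<l. L * N q)" using L(1) N(1) by (intro sum_nonneg) auto
  ultimately show ?thesis by blast
qed

lemma upper_unipotent_id_mat: "upper_unipotent d id_mat"
  by (auto simp: upper_unipotent_def id_mat_def)

text \<open>Translations are treated as affine maps with identity matrix, so that their
  measurability and measure preservation are instances of the general case.\<close>

lemma torus_cong_translate: "torus_cong d (affine_map d id_mat z x) (\<lambda>j. x j + z j)"
proof -
  have "affine_lift d id_mat z x j = x j + z j" if "j < d" for j
  proof -
    have "(\<Sum>i<d. x i * of_int (id_mat i j)) = (\<Sum>i<d. if i = j then x i else 0)"
      by (intro sum.cong) (auto simp: id_mat_def)
    then show ?thesis using that by (simp add: affine_lift_def)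
  qed
  then show ?thesis using torus_cong_affine_map[of d x x id_mat z] by (auto simp: torus_cong_def)
qed

text \<open>Records what the image condition supplies: a vector \<open>w\<close> that (A - Id)^k
  maps to e_d, the basis vector of index \<open>d - 1\<close>. Small multiples of \<open>w\<close>
  are the translations used for decoupling.\<close>

locale filiform =
  fixes d k :: nat and A :: "nat \<Rightarrow> nat \<Rightarrow> int" and b w :: "nat \<Rightarrow> real"
  assumes d: "0 < d" and k: "1 \<le> k" and uni: "upper_unipotent d A"
    and top: "\<And>j. j < d \<Longrightarrow> (linear_lift d (minus_id A) ^^ k) w j = (if j = d - 1 then 1 else 0)"
    and nil: "\<And>j. j < d \<Longrightarrow> (linear_lift d (minus_id A) ^^ Suc k) w j = 0"
begin

lemma nilpotent:
  assumes "k < i" "j < d"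
  shows "(linear_lift d (minus_id A) ^^ i) w j = 0"
  using assms
proof (induction i arbitrary: j)
  case (Suc i)
  show ?case
  proof (cases "i = k")
    case True
    then show ?thesis using nil[OF Suc.prems(2)] by simp
  next
    case False
    then have "(linear_lift d (minus_id A) ^^ i) w l = 0" if "l < d" for l using Suc that by auto
    then show ?thesis by (simp add: linear_lift_def[of d "minus_id A" "(linear_lift d (minus_id A) ^^ i) w"])
  qed
qed simp

text \<open>In the binomial expansion the terms beyond \<open>k\<close> vanish, those below
  \<open>k\<close> are of smaller order, and the \<open>k\<close>-th vector is e_d.\<close>

lemma shift_tendsto:
  assumes j: "j < d"
  shows "(\<lambda>n. (linear_lift d A ^^ n) w j / real (n choose k)) \<longlonglongrightarrow> (if j = d - 1 then 1 else 0)"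
proof -
  define r where "r i = (linear_lift d (minus_id A) ^^ i) w j" for i
  have eq: "(linear_lift d A ^^ n) w j / real (n choose k) = (\<Sum>i<k. real (n choose i) / real (n choose k) * r i) + r k" if "k \<le> n" for n
  proof -
    have "(linear_lift d A ^^ n) w j = (\<Sum>i\<le>n. real (n choose i) * r i)"
      unfolding r_def by (rule linear_lift_funpow_binomial[OF j])
    also have "\<dots> = (\<Sum>i\<le>k. real (n choose i) * r i)"
      using that nilpotent[OF _ j] by (intro sum.mono_neutral_right) (auto simp: r_def)
    also have "\<dots> = (\<Sum>i<k. real (n choose i) * r i) + real (n choose k) * r k"
      by (simp add: lessThan_Suc_atMost[symmetric])
    finally show ?thesis using that by (simp add: add_divide_distrib sum_divide_distrib)
  qed
  have "(\<lambda>n. (\<Sum>i<k. real (n choose i) / real (n choose k) * r i) + r k) \<longlonglongrightarrow> (\<Sum>i<k. 0 * r i) + r k"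
    by (intro tendsto_add tendsto_sum tendsto_mult binomial_ratio_tendsto_0 tendsto_const) auto
  moreover have "(\<Sum>i<k. 0 * r i) + r k = (if j = d - 1 then 1 else 0)" using top[OF j] by (simp add: r_def)
  ultimately have "(\<lambda>n. (\<Sum>i<k. real (n choose i) / real (n choose k) * r i) + r k) \<longlonglongrightarrow> (if j = d - 1 then 1 else 0)"
    by (simp only:)
  then show ?thesis
    by (rule Lim_transform_eventually) (use eq in \<open>auto simp: eventually_sequentially intro!: exI[of _ k]\<close>)
qed

text \<open>The last row of \<open>A\<close> is e_d, so e_d is fixed and a displacement along it
  persists unchanged through a Birkhoff sum.\<close>

lemma linear_lift_last:
  assumes "j < d"
  shows "(linear_lift d A ^^ n) (\<lambda>j. if j = d - 1 then t else 0) j = (if j = d - 1 then t else 0)"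
  using assms
proof (induction n arbitrary: j)
  case (Suc n)
  have "(linear_lift d A ^^ Suc n) (\<lambda>j. if j = d - 1 then t else 0) j = (\<Sum>i<d. (if i = d - 1 then t else 0) * of_int (A i j))"
    unfolding funpow.simps comp_def linear_lift_def[of d A "(linear_lift d A ^^ n) _"]
    by (intro sum.cong) (use Suc.IH in auto)
  also have "\<dots> = (\<Sum>i<d. if i = d - 1 then t * of_int (A i j) else 0)" by (intro sum.cong) auto
  also have "\<dots> = t * of_int (A (d - 1) j)" using d by simp
  also have "\<dots> = (if j = d - 1 then t else 0)"
  proof -
    have "A (d - 1) j = (if j = d - 1 then 1 else 0)"
      using uni d Suc.prems unfolding upper_unipotent_def by (cases "j = d - 1") auto
    then show ?thesis by simp
  qed
  finally show ?case .
qed simp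

abbreviation "T \<equiv> affine_map d A b"

text \<open>Along the last coordinate a Birkhoff sum is a trigonometric polynomial in
  \<open>t\<close> whose frequencies \<open>m (d - 1)\<close> depend neither on \<open>l\<close> nor
  on \<open>y\<close>; its coefficients do. This is why the bound of \<open>decoupling\<close> is
  uniform in \<open>l\<close>.\<close>

lemma birkhoff_lift_last:
  "(\<Sum>q<l. trig_sum d K c ((affine_lift d A b ^^ q) (\<lambda>j. y j + (if j = d - 1 then t else 0))))
   = (\<Sum>m\<in>K. (\<Sum>q<l. c m * cis (2 * pi * (\<Sum>i<d. of_int (m i) * (affine_lift d A b ^^ q) y i))) * cis (2 * pi * of_int (m (d - 1)) * t))"
proof -
  have "(\<Sum>i<d. of_int (m i) * (affine_lift d A b ^^ q) (\<lambda>j. y j + (if j = d - 1 then t else 0)) i)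
     = (\<Sum>i<d. of_int (m i) * (affine_lift d A b ^^ q) y i) + of_int (m (d - 1)) * t" for m :: "nat \<Rightarrow> int" and q
  proof -
    have "(\<Sum>i<d. of_int (m i) * (affine_lift d A b ^^ q) (\<lambda>j. y j + (if j = d - 1 then t else 0)) i)
      = (\<Sum>i<d. of_int (m i) * (affine_lift d A b ^^ q) y i + (if i = d - 1 then of_int (m i) * t else 0))"
      unfolding affine_lift_funpow_add by (intro sum.cong) (auto simp: linear_lift_last distrib_left simp del: One_nat_def)
    also have "\<dots> = (\<Sum>i<d. of_int (m i) * (affine_lift d A b ^^ q) y i) + of_int (m (d - 1)) * t"
      using d by (simp add: sum.distrib)
    finally show ?thesis .
  qed
  then show ?thesis
    unfolding trig_sum_def by (subst sum.swap) (simp add: distrib_left sum_distrib_right mult.assoc flip: cis_mult)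
qed

lemma T_measure_preserving: "measure_preserving (torus d) (affine_map d A' z)" if "upper_unipotent d A'"
  by (intro measure_preserving.intro measure_preserving_axioms.intro prob_space_imp_sigma_finite prob_space_torus
      affine_map_measurable distr_affine_map that)

text \<open>Translating by \<open>t w / (n choose k)\<close> hardly moves \<open>x\<close> but moves \<open>T^n x\<close> by nearly \<open>t e_d\<close>;
  averaging over \<open>t\<close> in \<open>{0, 1/M, ..., (M-1)/M}\<close> decouples \<open>S_l (T^n x)\<close> from \<open>S_l x\<close>.\<close>

lemma decoupling:
  fixes c :: "(nat \<Rightarrow> int) \<Rightarrow> complex" and R \<delta> :: real
  assumes K: "finite K" "\<And>m. m \<in> K \<Longrightarrow> m (d - 1) \<noteq> 0" and R: "0 < R" and \<delta>: "0 < \<delta>"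
  defines "S \<equiv> \<lambda>l. birkhoff_sum T l (trig_sum d K c)"
  shows "\<exists>\<kappa>\<ge>0. \<forall>l. \<forall>\<^sub>F n in sequentially.
     measure (torus d) {x \<in> space (torus d). norm (S l ((T ^^ n) x) - S l x) < 2 * R}
       \<le> \<delta> + measure (torus d) {x \<in> space (torus d). norm (S l x) \<le> \<kappa>}"
proof -
  interpret prob_space "torus d" by (rule prob_space_torus)
  interpret measure_preserving "torus d" T by (rule T_measure_preserving[OF uni])
  define D where "D = nat (\<Sum>m\<in>K. \<bar>m (d - 1)\<bar>)"
  have D: "m (d - 1) \<noteq> 0 \<and> \<bar>m (d - 1)\<bar> \<le> int D" if "m \<in> K" for m
    using K that member_le_sum[of m K "\<lambda>m. \<bar>m (d - 1)\<bar>"] by (auto simp: D_def)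
  \<comment> \<open>Orthogonality of roots of unity needs \<open>D < M\<close>; the other condition
    makes the proportion \<open>2 * D / M\<close> of exceptional samples at most
    \<open>\<delta>\<close>.\<close>
  obtain M :: nat where M: "2 * real D / \<delta> + real D < real M" using reals_Archimedean2 by blast
  have "0 \<le> 2 * real D / \<delta>" using \<delta> by simp
  then have DM: "D < M" and MD: "2 * real D / \<delta> \<le> real M" using M by linarith+
  have M0: "0 < real M" using DM by simp
  have MD': "2 * real D \<le> \<delta> * real M" using MD \<delta> by (simp add: field_simps)
  \<comment> \<open>The tolerance \<open>3 * R\<close> is \<open>2 * R\<close> from the event to be
    estimated plus \<open>R\<close> for the Lipschitz errors at both ends of the orbit.\<close>
  obtain \<kappa>' where \<kappa>': "\<And>a c. 2 * D < card {i. i < M \<and> norm ((\<Sum>m\<in>K. a m * cis (2 * pi * of_int (m (d - 1)) * real i / real M)) - c) \<le> 3 * R}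
     \<Longrightarrow> norm (\<Sum>m\<in>K. a m) \<le> \<kappa>'"
    using trig_sum_small_values[of K "\<lambda>m. m (d - 1)" D M "3 * R"] K(1) D DM R by auto
  define \<kappa> where "\<kappa> = max 0 \<kappa>'"
  have \<kappa>: "norm (\<Sum>m\<in>K. a m) \<le> \<kappa>"
    if "2 * D < card {i. i < M \<and> norm ((\<Sum>m\<in>K. a m * cis (2 * pi * of_int (m (d - 1)) * (real i / real M))) - c) \<le> 3 * R}" for a c
    using \<kappa>'[of a c] that by (simp add: \<kappa>_def)
  have S_meas [measurable]: "S l \<in> borel_measurable (torus d)" for l
    unfolding S_def by (intro birkhoff_sum_measurable trig_sum_measurable) measurable
  have "\<forall>\<^sub>F n in sequentially.
     prob {x \<in> space (torus d). norm (S l ((T ^^ n) x) - S l x) < 2 * R}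
       \<le> \<delta> + prob {x \<in> space (torus d). norm (S l x) \<le> \<kappa>}" for l
  proof -
    define G where "G y = (\<Sum>q<l. trig_sum d K c ((affine_lift d A b ^^ q) y))" for y
    have SG: "S l x = G y" if "torus_cong d x y" for x y
      unfolding S_def G_def by (rule birkhoff_sum_lift[OF that])
    obtain L where L: "0 \<le> L" "\<And>y y'. norm (G y - G y') \<le> L * (\<Sum>j<d. \<bar>y j - y' j\<bar>)"
      unfolding G_def using birkhoff_lift_lipschitz by blast
    \<comment> \<open>The first sum measures how far the displacement of the \<open>n\<close>-th
      iterate is from e_d, the second how far the starting point moves; both are taken for
      \<open>t = 1\<close>, the worst case in [0,1].\<close>
    define err where "err n = (\<Sum>j<d. \<bar>(linear_lift d A ^^ n) w j / real (n choose k) - (if j = d - 1 then 1 else 0)\<bar>)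
      + (\<Sum>j<d. \<bar>w j / real (n choose k)\<bar>)" for n
    have "err \<longlonglongrightarrow> (\<Sum>j<d. \<bar>(if j = d - 1 then 1 else 0) - (if j = d - 1 then 1 else 0)\<bar>) + (\<Sum>j<d. \<bar>w j * 0\<bar>)"
    proof -
      have "(\<lambda>n. 1 / real (n choose k)) \<longlonglongrightarrow> 0" using binomial_ratio_tendsto_0[of 0 k] k by simp
      then have "(\<lambda>n. w j * (1 / real (n choose k))) \<longlonglongrightarrow> w j * 0" for j by (rule tendsto_mult_left)
      then show ?thesis unfolding err_def[abs_def]
        by (intro tendsto_add tendsto_sum tendsto_rabs tendsto_diff shift_tendsto tendsto_const) auto
    qed
    then have "(\<lambda>n. L * err n) \<longlonglongrightarrow> L * 0" by (intro tendsto_mult_left) simp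
    then have "\<forall>\<^sub>F n in sequentially. L * err n < R" using R by (intro order_tendstoD(2)) auto
    then show ?thesis
    proof eventually_elim
      case (elim n)
      define W where "W x = S l ((T ^^ n) x) - S l x" for x
      have W_meas [measurable]: "W \<in> borel_measurable (torus d)" unfolding W_def by measurable
      define B where "B = {x \<in> space (torus d). norm (W x) < 2 * R}"
      have B [measurable]: "B \<in> sets (torus d)" unfolding B_def by measurable
      define z where "z i j = real i / real M * (w j / real (n choose k))" for i j
      define \<tau> where "\<tau> i = affine_map d id_mat (z i)" for i :: nat
      define Q where "Q = {x \<in> space (torus d). norm (S l ((T ^^ n) x)) \<le> \<kappa>}"
      have Q [measurable]: "Q \<in> sets (torus d)" unfolding Q_def by measurable
      have \<tau>_inv: "prob {x \<in> space (torus d). \<tau> i x \<in> B} = prob B" for i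
        using measure_preserving.measure_funpow_vimage[OF T_measure_preserving[OF upper_unipotent_id_mat, of "z i"] B, of 1]
        by (simp add: \<tau>_def)
      \<comment> \<open>Off \<open>Q\<close>, more than \<open>2 * D\<close> translates of
        \<open>x\<close> in \<open>B\<close> would bound \<open>S l ((T ^^ n) x)\<close> by
        \<open>\<kappa>\<close>, by the sampling lemma. Integrating the count over \<open>x\<close>,
        with each \<open>\<tau> i\<close> preserving the measure, then bounds the measure of
        \<open>B\<close>.\<close>
      have count: "(\<Sum>i<M. indicator {x \<in> space (torus d). \<tau> i x \<in> B} x) \<le> 2 * real D + real M * indicator Q x"
        if x: "x \<in> space (torus d)" for x
      proof (cases "x \<in> Q")
        case True
        have "(\<Sum>i<M. indicator {x \<in> space (torus d). \<tau> i x \<in> B} x) \<le> (\<Sum>i<M. 1 :: real)"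
          by (intro sum_mono) (auto simp: indicator_def)
        then show ?thesis using True by simp
      next
        case False
        define y where "y = (affine_lift d A b ^^ n) x"
        define a where "a m = (\<Sum>q<l. c m * cis (2 * pi * (\<Sum>i<d. of_int (m i) * (affine_lift d A b ^^ q) y i)))" for m
        have Gy: "G (\<lambda>j. y j + (if j = d - 1 then t else 0)) = (\<Sum>m\<in>K. a m * cis (2 * pi * of_int (m (d - 1)) * t))" for t
          unfolding G_def a_def by (rule birkhoff_lift_last)
        have "S l ((T ^^ n) x) = G y" unfolding y_def by (intro SG torus_cong_funpow) (simp add: torus_cong_def)
        also have "\<dots> = (\<Sum>m\<in>K. a m)" using Gy[of 0] by simp
        finally have big: "\<not> norm (\<Sum>m\<in>K. a m) \<le> \<kappa>" using False x by (simp add: Q_def)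
        \<comment> \<open>\<open>G x\<close> plays the role of the constant \<open>c\<close>: the
          starting point moves so little that the sum from it barely depends on
          \<open>i\<close>.\<close>
        have near: "norm ((\<Sum>m\<in>K. a m * cis (2 * pi * of_int (m (d - 1)) * (real i / real M))) - G x) \<le> 3 * R"
          if i: "i < M" and "\<tau> i x \<in> B" for i
        proof -
          define t where "t = real i / real M"
          have t: "0 \<le> t" "t \<le> 1" using i by (auto simp: t_def)
          have cong: "torus_cong d (\<tau> i x) (\<lambda>j. x j + z i j)" unfolding \<tau>_def by (rule torus_cong_translate)
          define v where "v j = y j + (linear_lift d A ^^ n) (z i) j" for j
          have "(affine_lift d A b ^^ n) (\<lambda>j. x j + z i j) = v"
            by (simp add: affine_lift_funpow_add v_def[abs_def] y_def)
          then have W: "W (\<tau> i x) = G v - G (\<lambda>j. x j + z i j)"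
            unfolding W_def SG[OF cong] using SG[OF torus_cong_funpow[OF cong]] by simp
          have lin: "(linear_lift d A ^^ n) (z i) j = t * ((linear_lift d A ^^ n) w j / real (n choose k))" for j
          proof -
            have "z i = (\<lambda>j. (t / real (n choose k)) * w j)" by (auto simp: z_def t_def)
            then show ?thesis by (simp only: linear_lift_funpow_scale) simp
          qed
          have e1: "norm (G (\<lambda>j. y j + (if j = d - 1 then t else 0)) - G v)
             \<le> L * (\<Sum>j<d. \<bar>(linear_lift d A ^^ n) w j / real (n choose k) - (if j = d - 1 then 1 else 0)\<bar>)"
            using L(2)
          proof (rule order_trans, intro mult_left_mono sum_mono L(1))
            fix j
            have "(y j + (if j = d - 1 then t else 0)) - v j
               = t * ((if j = d - 1 then 1 else 0) - (linear_lift d A ^^ n) w j / real (n choose k))"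
              by (simp add: v_def lin algebra_simps)
            then have "\<bar>(y j + (if j = d - 1 then t else 0)) - v j\<bar> =
               t * \<bar>(linear_lift d A ^^ n) w j / real (n choose k) - (if j = d - 1 then 1 else 0)\<bar>"
              using t by (simp only: abs_mult abs_minus_commute)
            also have "\<dots> \<le> 1 * \<bar>(linear_lift d A ^^ n) w j / real (n choose k) - (if j = d - 1 then 1 else 0)\<bar>"
              using t by (intro mult_right_mono) auto
            finally show "\<bar>(y j + (if j = d - 1 then t else 0)) - v j\<bar> \<le>
               \<bar>(linear_lift d A ^^ n) w j / real (n choose k) - (if j = d - 1 then 1 else 0)\<bar>" by simp
          qed
          have e2: "norm (G (\<lambda>j. x j + z i j) - G x) \<le> L * (\<Sum>j<d. \<bar>w j / real (n choose k)\<bar>)"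
            using L(2)
          proof (rule order_trans, intro mult_left_mono sum_mono L(1))
            fix j
            have "\<bar>x j + z i j - x j\<bar> = t * \<bar>w j / real (n choose k)\<bar>" using t by (simp add: z_def t_def abs_mult)
            also have "\<dots> \<le> 1 * \<bar>w j / real (n choose k)\<bar>" using t by (intro mult_right_mono) auto
            finally show "\<bar>x j + z i j - x j\<bar> \<le> \<bar>w j / real (n choose k)\<bar>" by simp
          qed
          have e12: "norm (G (\<lambda>j. y j + (if j = d - 1 then t else 0)) - G v) + norm (G (\<lambda>j. x j + z i j) - G x) < R"
            using add_mono[OF e1 e2] elim unfolding err_def distrib_left by linarith
          have "G (\<lambda>j. y j + (if j = d - 1 then t else 0)) - G x
             = (G (\<lambda>j. y j + (if j = d - 1 then t else 0)) - G v) + (W (\<tau> i x) + (G (\<lambda>j. x j + z i j) - G x))"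
            by (simp add: W)
          then have "norm (G (\<lambda>j. y j + (if j = d - 1 then t else 0)) - G x)
            \<le> norm (G (\<lambda>j. y j + (if j = d - 1 then t else 0)) - G v) + (norm (W (\<tau> i x)) + norm (G (\<lambda>j. x j + z i j) - G x))"
            by (simp only: order_trans[OF norm_triangle_ineq add_left_mono[OF norm_triangle_ineq]])
          also have "\<dots> \<le> 3 * R" using e12 \<open>\<tau> i x \<in> B\<close> by (simp add: B_def)
          finally show ?thesis unfolding Gy t_def .
        qed
        have "card {i. i < M \<and> \<tau> i x \<in> B} \<le> card {i. i < M \<and> norm ((\<Sum>m\<in>K. a m * cis (2 * pi * of_int (m (d - 1)) * (real i / real M))) - G x) \<le> 3 * R}"
          by (intro card_mono) (use near in auto)
        also have "\<dots> \<le> 2 * D" using \<kappa>[of a "G x"] big by (meson not_le)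
        finally have "card {i. i < M \<and> \<tau> i x \<in> B} \<le> 2 * D" .
        moreover have "(\<Sum>i<M. indicator {x \<in> space (torus d). \<tau> i x \<in> B} x) = real (card {i. i < M \<and> \<tau> i x \<in> B})"
        proof -
          have "{..<M} \<inter> {i. \<tau> i x \<in> B} = {i. i < M \<and> \<tau> i x \<in> B}" by auto
          then show ?thesis using x by (simp add: indicator_def sum.If_cases)
        qed
        ultimately show ?thesis using False by simp
      qed
      have \<tau>B [measurable]: "{x \<in> space (torus d). \<tau> i x \<in> B} \<in> sets (torus d)" for i
        unfolding \<tau>_def by measurable
      have int: "integrable (torus d) (indicat_real X)" if "X \<in> sets (torus d)" for X
        using that by (intro integrable_real_indicator) (auto simp: less_top[symmetric])
      have "real M * prob B = (\<Sum>i<M. prob {x \<in> space (torus d). \<tau> i x \<in> B})" by (simp add: \<tau>_inv)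
      also have "\<dots> = (\<integral>x. (\<Sum>i<M. indicator {x \<in> space (torus d). \<tau> i x \<in> B} x) \<partial>torus d)"
        by (subst Bochner_Integration.integral_sum) (auto intro!: int \<tau>B simp: sets.Int_space_eq2[OF \<tau>B])
      also have "\<dots> \<le> (\<integral>x. 2 * real D + real M * indicator Q x \<partial>torus d)"
        by (intro integral_mono count Bochner_Integration.integrable_sum Bochner_Integration.integrable_add integrable_mult_right int \<tau>B Q) auto
      also have "\<dots> = 2 * real D + real M * prob Q"
        using int[OF Q] by (subst Bochner_Integration.integral_add) (auto simp: prob_space sets.Int_space_eq2)
      also have "\<dots> \<le> real M * (\<delta> + prob Q)" using MD' by (simp add: algebra_simps)
      finally have "prob B \<le> \<delta> + prob Q" using M0 by simp
      moreover have "prob Q = prob {x \<in> space (torus d). norm (S l x) \<le> \<kappa>}"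
      proof -
        have "prob {x \<in> space (torus d). (T ^^ n) x \<in> {x \<in> space (torus d). norm (S l x) \<le> \<kappa>}}
          = prob {x \<in> space (torus d). norm (S l x) \<le> \<kappa>}"
          by (rule measure_funpow_vimage) measurable
        moreover have "{x \<in> space (torus d). (T ^^ n) x \<in> {x \<in> space (torus d). norm (S l x) \<le> \<kappa>}} = Q"
          using funpow_space by (auto simp: Q_def)
        ultimately show ?thesis by simp
      qed
      ultimately show ?case by (simp add: B_def W_def)
    qed
  qed
  then show ?thesis by (intro exI[of _ \<kappa>]) (simp add: \<kappa>_def)
qed

end

section \<open>Vanishing concentration\<close>

text \<open>Were there a large value among s, 2s, ..., (J-1)s for every s, then summing over s and
  exchanging sums would count each \<open>g l\<close> at most once for each factor r, so that the
  averages of \<open>g\<close> would stay bounded below.\<close>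

lemma sparse_progression:
  fixes g :: "nat \<Rightarrow> real"
  assumes g: "\<And>n. 0 \<le> g n" and J: "2 \<le> J" and \<theta>: "0 < \<theta>" "\<theta> \<le> g 0"
    and sparse: "\<And>c. 0 < c \<Longrightarrow> \<exists>N. (\<Sum>l<N. g l) < c * real N"
  shows "\<exists>s. \<forall>r\<in>{1..<J}. g (r * s) < \<theta>"
proof (rule ccontr)
  assume "\<nexists>s. \<forall>r\<in>{1..<J}. g (r * s) < \<theta>"
  then have dense: "\<exists>r\<in>{1..<J}. \<theta> \<le> g (r * s)" for s by (meson not_le)
  \<comment> \<open>One factor \<open>J\<close> pays for the number of values of \<open>r\<close>,
    the other for the ratio of \<open>N\<close> to \<open>m + 1\<close>.\<close>
  obtain N where N: "(\<Sum>l<N. g l) < \<theta> / real (J * J) * real N"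
    using sparse[of "\<theta> / real (J * J)"] \<theta> J by auto
  have "N \<noteq> 0"
  proof
    assume "N = 0"
    then show False using N by simp
  qed
  \<comment> \<open>The largest \<open>m\<close> with \<open>J * m < N\<close>: all products
    \<open>r * s\<close> with \<open>s \<le> m\<close> stay below \<open>N\<close>, and still
    \<open>N \<le> J * (m + 1)\<close>.\<close>
  define m where "m = (N - 1) div J"
  have "N - 1 < J * (m + 1)" using dividend_less_times_div[of J "N - 1"] J by (simp add: m_def algebra_simps)
  then have NJ: "N \<le> J * (m + 1)" by simp
  have Jm: "J * m < N" using \<open>N \<noteq> 0\<close> times_div_less_eq_dividend[of J "N - 1"] unfolding m_def by linarith
  have "real (m + 1) * \<theta> = (\<Sum>s\<in>{..m}. \<theta>)" by simp
  also have "\<dots> \<le> (\<Sum>s\<in>{..m}. \<Sum>r\<in>{1..<J}. g (r * s))"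
  proof (rule sum_mono)
    fix s
    obtain r where r: "r \<in> {1..<J}" "\<theta> \<le> g (r * s)" using dense by blast
    then show "\<theta> \<le> (\<Sum>r\<in>{1..<J}. g (r * s))"
      using g member_le_sum[of r "{1..<J}" "\<lambda>r. g (r * s)"] by auto
  qed
  also have "\<dots> = (\<Sum>r\<in>{1..<J}. \<Sum>s\<in>{..m}. g (r * s))" by (rule sum.swap)
  also have "\<dots> \<le> (\<Sum>r\<in>{1..<J}. \<Sum>l<N. g l)"
  proof (rule sum_mono)
    fix r assume r: "r \<in> {1..<J}"
    have "(\<Sum>s\<in>{..m}. g (r * s)) = (\<Sum>l\<in>(\<lambda>s. r * s) ` {..m}. g l)"
      using r by (subst sum.reindex) (auto simp: inj_on_def)
    also have "\<dots> \<le> (\<Sum>l<N. g l)"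
    proof (rule sum_mono2)
      show "(\<lambda>s. r * s) ` {..m} \<subseteq> {..<N}"
      proof safe
        fix s assume "s \<le> m"
        then have "r * s \<le> J * m" using r by (intro mult_le_mono) auto
        then show "r * s < N" using Jm by simp
      qed
    qed (use g in simp_all)
    finally show "(\<Sum>s\<in>{..m}. g (r * s)) \<le> (\<Sum>l<N. g l)" .
  qed
  also have "\<dots> = real (J - 1) * (\<Sum>l<N. g l)" by simp
  also have "\<dots> \<le> real J * (\<Sum>l<N. g l)" by (intro mult_right_mono sum_nonneg g) auto
  also have "\<dots> < real J * (\<theta> / real (J * J) * real N)" using N J by (intro mult_strict_left_mono) auto
  also have "\<dots> = \<theta> * (real N / real J)" using J by (simp add: field_simps)
  also have "\<dots> \<le> \<theta> * real (m + 1)"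
  proof (rule mult_left_mono)
    have "real N \<le> real J * real (m + 1)" using NJ by (simp only: of_nat_mult[symmetric] of_nat_le_iff)
    then show "real N / real J \<le> real (m + 1)" using J by (simp add: field_simps)
  qed (use \<theta> in simp)
  finally show False by simp
qed

section \<open>Overlaps among many events of equal size\<close>

context prob_space
begin

text \<open>A crude Bonferroni inequality: each new event loses to the union of the earlier ones at
  most \<open>\<gamma>\<close> per earlier event.\<close>

lemma prob_UN_ge:
  fixes G :: "nat \<Rightarrow> 'a set"
  assumes "\<And>i. i < m \<Longrightarrow> G i \<in> events" "\<And>i. i < m \<Longrightarrow> \<epsilon> \<le> prob (G i)" "0 \<le> \<gamma>"
    and "\<And>i j. i < j \<Longrightarrow> j < m \<Longrightarrow> prob (G i \<inter> G j) \<le> \<gamma>"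
  shows "real m * \<epsilon> - real m * real m * \<gamma> \<le> prob (\<Union>i<m. G i)"
  using assms
proof (induction m)
  case (Suc m)
  have G: "G i \<in> events" if "i \<le> m" for i using Suc.prems(1) that by simp
  have "prob ((\<Union>i<m. G i) \<inter> G m) \<le> (\<Sum>i<m. prob (G i \<inter> G m))"
    unfolding Int_UN_distrib2 [symmetric] UN_simps(4)[symmetric]
    by (rule order_trans[OF _ finite_measure_subadditive_finite]) (use G in \<open>auto simp: UN_simps\<close>)
  also have "\<dots> \<le> (\<Sum>i<m. \<gamma>)" using Suc.prems(4) by (intro sum_mono) auto
  finally have "prob ((\<Union>i<m. G i) \<inter> G m) \<le> real m * \<gamma>" by simp
  moreover have "prob (\<Union>i<Suc m. G i) = prob (\<Union>i<m. G i) + prob (G m) - prob ((\<Union>i<m. G i) \<inter> G m)"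
  proof -
    have U: "(\<Union>i<m. G i) \<in> events" using G by auto
    have "prob ((\<Union>i<m. G i) \<union> G m) = prob (\<Union>i<m. G i) + prob (G m - (\<Union>i<m. G i))"
      using U G[of m] by (subst finite_measure_Union[symmetric]) auto
    also have "prob (G m - (\<Union>i<m. G i)) = prob (G m) - prob (G m \<inter> (\<Union>i<m. G i))"
      using U G[of m] by (intro finite_measure_Diff') auto
    finally show ?thesis by (simp add: lessThan_Suc Un_commute Int_commute)
  qed
  moreover have "real m * \<epsilon> - real m * real m * \<gamma> \<le> prob (\<Union>i<m. G i)" using Suc by auto
  moreover have "\<epsilon> \<le> prob (G m)" using Suc.prems(2) by simp
  moreover have "real (Suc m) * \<epsilon> - real (Suc m) * real (Suc m) * \<gamma> \<le> (real m * \<epsilon> - real m * real m * \<gamma>) + \<epsilon> - real m * \<gamma>"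
    using Suc.prems(3) by (simp add: algebra_simps)
  ultimately show ?case by linarith
qed simp

text \<open>Otherwise the preceding bound would give the union probability at least 2 - 1/2.\<close>

lemma two_events_overlap:
  fixes G :: "nat \<Rightarrow> 'a set"
  assumes "\<And>i. i < J \<Longrightarrow> G i \<in> events" "\<And>i. i < J \<Longrightarrow> \<epsilon> \<le> prob (G i)" "2 \<le> real J * \<epsilon>"
  shows "\<exists>i j. i < j \<and> j < J \<and> 1 / (2 * real J * real J) < prob (G i \<inter> G j)"
proof (rule ccontr)
  assume "\<nexists>i j. i < j \<and> j < J \<and> 1 / (2 * real J * real J) < prob (G i \<inter> G j)"
  then have "prob (G i \<inter> G j) \<le> 1 / (2 * real J * real J)" if "i < j" "j < J" for i j
    using that by (meson not_le)
  then have "real J * \<epsilon> - real J * real J * (1 / (2 * real J * real J)) \<le> prob (\<Union>i<J. G i)"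
    using assms(1,2) by (intro prob_UN_ge) simp_all
  moreover have "J \<noteq> 0" using assms(3) by (intro notI) simp
  ultimately have "2 - 1 / 2 \<le> prob (\<Union>i<J. G i)" using assms(3) by simp
  then show False using prob_le_1[of "\<Union>i<J. G i"] by simp
qed

end

text \<open>The normalised restriction of Lebesgue measure to an invariant set of measure strictly
  between 0 and 1 would be a second invariant probability measure.\<close>

lemma ergodic_prob_affine_map:
  assumes uni: "upper_unipotent d A" and ue: "uniquely_ergodic d (affine_map d A b)"
  shows "ergodic_prob (torus d) (affine_map d A b)"
proof -
  let ?M = "torus d" and ?T = "affine_map d A b"
  interpret prob_space ?M by (rule prob_space_torus)
  interpret measure_preserving ?M ?T
    by (intro measure_preserving.intro measure_preserving_axioms.intro prob_space_imp_sigma_finite prob_space_torus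
        affine_map_measurable distr_affine_map uni)
  have unique: "\<mu> = ?M" if "sets \<mu> = sets ?M" "prob_space \<mu>" "?T \<in> measurable \<mu> \<mu>" "distr \<mu> \<mu> ?T = \<mu>" for \<mu>
    using ue that prob_space_axioms T_measurable distr_T unfolding uniquely_ergodic_def by blast
  have "measure ?M B = 0 \<or> measure ?M B = 1"
    if B [measurable]: "B \<in> sets ?M" and inv: "\<And>x. x \<in> space ?M \<Longrightarrow> ?T x \<in> B \<longleftrightarrow> x \<in> B" for B
  proof (rule ccontr)
    assume "\<not> (measure ?M B = 0 \<or> measure ?M B = 1)"
    then have p0: "prob B \<noteq> 0" and p1: "prob B \<noteq> 1" by auto
    have pe: "emeasure ?M B \<noteq> 0" "emeasure ?M B \<noteq> \<infinity>" using p0 by (auto simp: emeasure_eq_measure)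
    define \<mu> where "\<mu> = uniform_measure ?M B"
    have sets: "sets \<mu> = sets ?M" and space: "space \<mu> = space ?M" by (simp_all add: \<mu>_def)
    have T\<mu>: "?T \<in> measurable \<mu> \<mu>" using T_measurable measurable_cong_sets[OF sets sets] by simp
    have "distr \<mu> \<mu> ?T = \<mu>"
    proof (rule measure_eqI)
      fix X assume "X \<in> sets (distr \<mu> \<mu> ?T)"
      then have X [measurable]: "X \<in> sets ?M" by (simp add: sets)
      have "emeasure (distr \<mu> \<mu> ?T) X = emeasure \<mu> (?T -` X \<inter> space ?M)"
        using X T\<mu> by (simp add: emeasure_distr sets space)
      also have "\<dots> = emeasure ?M (B \<inter> (?T -` X \<inter> space ?M)) / emeasure ?M B"
        unfolding \<mu>_def by (rule emeasure_uniform_measure) auto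
      also have "B \<inter> (?T -` X \<inter> space ?M) = ?T -` (B \<inter> X) \<inter> space ?M" using inv by auto
      also have "emeasure ?M \<dots> = emeasure (distr ?M ?M ?T) (B \<inter> X)" by (rule emeasure_distr[symmetric]) auto
      also have "\<dots> / emeasure ?M B = emeasure \<mu> X"
        unfolding \<mu>_def distr_T by (rule emeasure_uniform_measure[symmetric]) auto
      finally show "emeasure (distr \<mu> \<mu> ?T) X = emeasure \<mu> X" .
    qed simp
    with unique[OF sets _ T\<mu>] prob_space_uniform_measure[OF pe] have "\<mu> = ?M" by (simp add: \<mu>_def)
    then have "measure \<mu> B = prob B" by simp
    moreover have "measure \<mu> B = prob B / prob B"
      unfolding \<mu>_def using B p0 by (subst measure_uniform_measure) (use pe in auto)
    ultimately show False using p0 p1 by simp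
  qed
  then show ?thesis
    by (intro ergodic_prob.intro ergodic_prob_axioms.intro prob_space_axioms measure_preserving_axioms) blast
qed

text \<open>The real and imaginary parts cannot both be coboundaries, since their transfer functions
  would combine to a complex one. For a part that is not, the positive-density criterion must fail,
  and its sums are dominated in modulus by those of \<open>\<Psi>\<close>.\<close>

lemma sum_prob_birkhoff_sublinear:
  assumes erg: "ergodic_prob (torus d) T"
    and \<Psi> [measurable]: "\<Psi> \<in> borel_measurable (torus d)"
    and ncob: "\<not> measurable_coboundary d T \<Psi>" and c: "0 < c"
  shows "\<exists>N. (\<Sum>l<N. measure (torus d) {x \<in> space (torus d). norm (birkhoff_sum T l \<Psi> x) \<le> \<kappa>}) < c * real N"
proof -
  interpret ergodic_prob "torus d" T by (rule erg)
  have part: "\<exists>N. (\<Sum>l<N. prob {x \<in> space (torus d). norm (birkhoff_sum T l \<Psi> x) \<le> \<kappa>}) < c * real N"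
    if f [measurable]: "f \<in> borel_measurable borel" and f_sum: "\<And>(g :: nat \<Rightarrow> complex) l. f (\<Sum>i<l. g i) = (\<Sum>i<l. f (g i))"
      and f_le: "\<And>z. \<bar>f z\<bar> \<le> norm z"
      and no: "\<not> (\<exists>u \<in> borel_measurable (torus d). AE x in torus d. f (\<Psi> x) = u (T x) - u x)"
    for f :: "complex \<Rightarrow> real"
  proof -
    have "(\<lambda>x. f (\<Psi> x)) \<in> borel_measurable (torus d)" by measurable
    from coboundary_of_positive_density[OF this c, of \<kappa>] no
    obtain N where N: "(\<Sum>l<N. prob {x \<in> space (torus d). \<bar>\<Sum>i<l. f (\<Psi> ((T ^^ i) x))\<bar> \<le> \<kappa>}) < c * real N"
      by (meson not_le)
    have "prob {x \<in> space (torus d). norm (birkhoff_sum T l \<Psi> x) \<le> \<kappa>}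
       \<le> prob {x \<in> space (torus d). \<bar>\<Sum>i<l. f (\<Psi> ((T ^^ i) x))\<bar> \<le> \<kappa>}" for l
    proof (rule finite_measure_mono)
      show "{x \<in> space (torus d). norm (birkhoff_sum T l \<Psi> x) \<le> \<kappa>}
         \<subseteq> {x \<in> space (torus d). \<bar>\<Sum>i<l. f (\<Psi> ((T ^^ i) x))\<bar> \<le> \<kappa>}"
        using f_le order_trans unfolding birkhoff_sum_def f_sum[symmetric] by blast
    qed measurable
    then show ?thesis using N sum_mono by (meson le_less_trans)
  qed
  show ?thesis
  proof (cases "\<exists>u \<in> borel_measurable (torus d). AE x in torus d. Re (\<Psi> x) = u (T x) - u x")
    case False
    then show ?thesis by (intro part[of Re]) (auto simp: abs_Re_le_cmod)
  next
    case True
    then obtain u where u [measurable]: "u \<in> borel_measurable (torus d)" and ueq: "AE x in torus d. Re (\<Psi> x) = u (T x) - u x"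
      by blast
    have "\<not> (\<exists>v \<in> borel_measurable (torus d). AE x in torus d. Im (\<Psi> x) = v (T x) - v x)"
    proof
      assume "\<exists>v \<in> borel_measurable (torus d). AE x in torus d. Im (\<Psi> x) = v (T x) - v x"
      then obtain v where v [measurable]: "v \<in> borel_measurable (torus d)" and veq: "AE x in torus d. Im (\<Psi> x) = v (T x) - v x"
        by blast
      define U where "U x = complex_of_real (u x) + \<i> * complex_of_real (v x)" for x
      have "U \<in> borel_measurable (torus d)" unfolding U_def by measurable
      moreover have "AE x in torus d. \<Psi> x = U (T x) - U x"
        using ueq veq by eventually_elim (simp add: U_def complex_eq_iff)
      ultimately have "measurable_coboundary d T \<Psi>"
        unfolding measurable_coboundary_def by (intro bexI[of _ U])
      then show False using ncob by simp
    qed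
    then show ?thesis by (intro part[of Im]) (auto simp: abs_Im_le_cmod)
  qed
qed

theorem theorem2p5:
  fixes d k :: nat and A :: "nat \<Rightarrow> nat \<Rightarrow> int" and b :: "nat \<Rightarrow> real"
    and \<Psi> :: "(nat \<Rightarrow> real) \<Rightarrow> complex" and C :: real
  assumes "d \<ge> 2"
    and "upper_unipotent d A"
    and "\<not> mat_is_zero d (minus_id A)"
    and "uniquely_ergodic d (affine_map d A b)"
    and "k \<ge> 1"
    and "\<not> mat_is_zero d (mat_pow d (minus_id A) k)"
    and "mat_is_zero d (mat_pow d (minus_id A) (k + 1))"
    and "{row_mult d y (mat_pow d (minus_id A) k) | y. True}
         = {(\<lambda>j\<in>{..<d}. if j = d - 1 then c else 0) | c. True}"
    and "\<Psi> \<in> Qd d"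
    and "\<not> measurable_coboundary d (affine_map d A b) \<Psi>"
    and "C > 1"
  shows "(\<lambda>n. measure (torus d)
            {x \<in> space (torus d). cmod (birkhoff_sum (affine_map d A b) n \<Psi> x) < C})
         \<longlonglongrightarrow> 0"
proof -
  define T where "T = affine_map d A b"
  have d: "0 < d" using assms(1) by simp
  have "(\<lambda>j\<in>{..<d}. if j = d - 1 then 1 else 0 :: real) \<in> {row_mult d y (mat_pow d (minus_id A) k) | y. True}"
    unfolding assms(8) by blast
  then obtain w where w: "(\<lambda>j\<in>{..<d}. if j = d - 1 then 1 else 0) = row_mult d w (mat_pow d (minus_id A) k)"
    by blast
  interpret F: filiform d k A b w
  proof
    fix j assume j: "j < d"
    have "(linear_lift d (minus_id A) ^^ k) w j = row_mult d w (mat_pow d (minus_id A) k) j"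
      using j by (simp add: linear_lift_funpow_mat_pow row_mult_def)
    then show "(linear_lift d (minus_id A) ^^ k) w j = (if j = d - 1 then 1 else 0)"
      using j by (simp flip: w)
    have "(linear_lift d (minus_id A) ^^ Suc k) w j = (\<Sum>i<d. w i * of_int (mat_pow d (minus_id A) (k + 1) i j))"
      unfolding Suc_eq_plus1 by (rule linear_lift_funpow_mat_pow[OF j])
    also have "\<dots> = 0" using assms(7) j by (intro sum.neutral) (auto simp: mat_is_zero_def simp del: mat_pow.simps)
    finally show "(linear_lift d (minus_id A) ^^ Suc k) w j = 0" .
  qed (use d assms in auto)
  have erg: "ergodic_prob (torus d) T" unfolding T_def by (rule ergodic_prob_affine_map) fact+
  interpret ergodic_prob "torus d" T by (rule erg)
  obtain K c where K: "finite K" "\<And>m. m \<in> K \<Longrightarrow> m (d - 1) \<noteq> 0" and \<Psi>: "\<Psi> = trig_sum d K c"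
    using trig_sum_Qd[OF d assms(9)] by blast
  define S where "S n = birkhoff_sum T n \<Psi>" for n
  have \<Psi>_meas: "\<Psi> \<in> borel_measurable (torus d)" unfolding \<Psi> by (rule trig_sum_measurable)
  have S_meas [measurable]: "S n \<in> borel_measurable (torus d)" for n
    unfolding S_def by (rule birkhoff_sum_measurable[OF T_measurable \<Psi>_meas])
  define E where "E n = {x \<in> space (torus d). norm (S n x) < C}" for n
  have E [measurable]: "E n \<in> events" for n unfolding E_def by measurable
  have "\<forall>\<^sub>F n in sequentially. prob (E n) < \<epsilon>" if \<epsilon>: "0 < \<epsilon>" for \<epsilon>
  proof -
    \<comment> \<open>With \<open>2 \<le> J * \<epsilon>\<close>, events of measure at least
      \<open>\<epsilon>\<close> cannot be nearly disjoint when there are \<open>J\<close> of them;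
      \<open>\<gamma>\<close> below is the overlap this guarantees. The maximum with 2 is for
      \<open>sparse_progression\<close>.\<close>
    obtain J0 :: nat where "2 / \<epsilon> < real J0" using reals_Archimedean2 by blast
    then have "2 \<le> real J0 * \<epsilon>" using \<epsilon> by (simp add: field_simps)
    define J where "J = max 2 J0"
    have J: "2 \<le> J" by (simp add: J_def)
    have "real J0 * \<epsilon> \<le> real J * \<epsilon>" using \<epsilon> by (intro mult_right_mono) (auto simp: J_def)
    then have J\<epsilon>: "2 \<le> real J * \<epsilon>" using \<open>2 \<le> real J0 * \<epsilon>\<close> by simp
    define \<gamma> where "\<gamma> = 1 / (2 * real J * real J)"
    have \<gamma>: "0 < \<gamma>" using J by (simp add: \<gamma>_def)
    have "\<gamma> \<le> 1" using J mult_mono[of 1 "real J" 1 "real J"] by (simp add: \<gamma>_def divide_le_eq_1)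
    \<comment> \<open>\<open>\<kappa>\<close> does not depend on \<open>l\<close>, so it can be
      fixed before the step \<open>s\<close> is chosen. Half of \<open>\<gamma>\<close> is allotted
      to decoupling, the other half to \<open>g\<close>.\<close>
    obtain \<kappa> where \<kappa>: "0 \<le> \<kappa>" and dec: "\<And>l. \<forall>\<^sub>F n in sequentially.
        prob {x \<in> space (torus d). norm (S l ((T ^^ n) x) - S l x) < 2 * C}
          \<le> \<gamma> / 2 + prob {x \<in> space (torus d). norm (S l x) \<le> \<kappa>}"
      using F.decoupling[of K C "\<gamma> / 2" c] K assms(11) \<gamma> unfolding S_def \<Psi> T_def by auto
    define g where "g l = prob {x \<in> space (torus d). norm (S l x) \<le> \<kappa>}" for l
    have "g 0 = 1" using \<kappa> prob_space by (simp add: g_def S_def birkhoff_sum_def)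
    then have "\<exists>s. \<forall>r\<in>{1..<J}. g (r * s) < \<gamma> / 2"
      using sum_prob_birkhoff_sublinear[OF erg \<Psi>_meas, of _ \<kappa>] assms(10) J \<gamma> \<open>\<gamma> \<le> 1\<close>
      by (intro sparse_progression) (auto simp: g_def S_def T_def)
    then obtain s where s: "\<And>r. r \<in> {1..<J} \<Longrightarrow> g (r * s) < \<gamma> / 2" by blast
    \<comment> \<open>With \<open>s\<close> fixed, only finitely many lengths \<open>r * s\<close>
      occur, so a common threshold for \<open>n\<close> exists.\<close>
    have "\<forall>\<^sub>F n in sequentially. \<forall>r\<in>{1..<J}.
        prob {x \<in> space (torus d). norm (S (r * s) ((T ^^ n) x) - S (r * s) x) < 2 * C} \<le> \<gamma> / 2 + g (r * s)"
      using dec unfolding g_def by (intro eventually_ball_finite) auto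
    then show ?thesis
    proof eventually_elim
      case (elim n)
      show ?case
      proof (rule ccontr)
        assume "\<not> prob (E n) < \<epsilon>"
        then have big: "\<epsilon> \<le> prob (E n)" by simp
        \<comment> \<open>Preimages of \<open>E n\<close> along the progression. An overlap of those
          for \<open>a < a'\<close> means that many points of \<open>E n\<close> are back in it at
          time \<open>(a' - a) * s\<close>, one of the lengths at which \<open>g\<close> is
          small.\<close>
        define G where "G a = {x \<in> space (torus d). (T ^^ (a * s)) x \<in> E n}" for a
        have G: "G a \<in> events" "prob (G a) = prob (E n)" for a
          unfolding G_def using measure_funpow_vimage[OF E] by auto
        obtain a a' where a: "a < a'" "a' < J" and overlap: "\<gamma> < prob (G a \<inter> G a')"
          using two_events_overlap[of J G \<epsilon>] G big J\<epsilon> unfolding \<gamma>_def by auto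
        define l where "l = (a' - a) * s"
        define B where "B = {x \<in> space (torus d). x \<in> E n \<and> (T ^^ l) x \<in> E n}"
        have B [measurable]: "B \<in> events" unfolding B_def by measurable
        have "a' * s = l + a * s" using a by (simp add: l_def diff_mult_distrib)
        then have iter: "(T ^^ (a' * s)) x = (T ^^ l) ((T ^^ (a * s)) x)" for x by (simp add: funpow_add)
        have "G a \<inter> G a' = {x \<in> space (torus d). (T ^^ (a * s)) x \<in> B}"
          using funpow_space by (auto simp: G_def B_def iter)
        then have "\<gamma> < prob B" using overlap measure_funpow_vimage[OF B] by simp
        also have "prob B \<le> prob {x \<in> space (torus d). norm (S l ((T ^^ n) x) - S l x) < 2 * C}"
        proof (rule finite_measure_mono)
          show "B \<subseteq> {x \<in> space (torus d). norm (S l ((T ^^ n) x) - S l x) < 2 * C}"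
          proof
            fix x assume x: "x \<in> B"
            have "norm (S l ((T ^^ n) x) - S l x) = norm (S n ((T ^^ l) x) - S n x)"
              unfolding S_def birkhoff_sum_commute[of T n \<Psi> l x] ..
            also have "\<dots> \<le> norm (S n ((T ^^ l) x)) + norm (S n x)" by (rule norm_triangle_ineq4)
            also have "\<dots> < 2 * C" using x by (simp add: B_def E_def)
            finally show "x \<in> {x \<in> space (torus d). norm (S l ((T ^^ n) x) - S l x) < 2 * C}"
              using x by (simp add: B_def)
          qed
        qed measurable
        also have "\<dots> \<le> \<gamma> / 2 + g l" unfolding l_def by (rule bspec[OF elim]) (use a in auto)
        also have "g l < \<gamma> / 2" unfolding l_def by (rule s) (use a in auto)
        finally show False by simp
      qed
    qed
  qed
  then have "(\<lambda>n. prob (E n)) \<longlonglongrightarrow> 0"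
  proof (intro order_tendstoI)
    fix a :: real assume "a < 0"
    then show "\<forall>\<^sub>F n in sequentially. a < prob (E n)"
      by (intro always_eventually allI less_le_trans[OF _ measure_nonneg])
  qed
  then show ?thesis by (simp add: E_def S_def T_def)
qed

end
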